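(* Let $\mu$ be a rotation-invariant positive Borel measure on $\mathbb{C}^n$ ($n\ge1$) such that $m_d=\int_{\mathbb{C}^n}|z|^{2d}\,d\mu$ satisfies $0<m_d<\infty$ for all $d\in\mathbb{N}$. Then the canonical solution operator to $\bar\partial$ is compact on $A^2_{(0,1)}(d\mu)$ if and only if $$\lim_{d\to\infty}\left(\frac{(2n+d-1)\,m_{d+1}}{(n+d)\,m_d}-\frac{m_d}{m_{d-1}}\right)=0 .$$
   Context: $\mathbb{N}=\{0,1,2,\dots\}$; $|z|^2=\sum_j|z_j|^2$. Rotation-invariant means invariant under the unitary group $U(n)$; in particular the monomials are pairwise orthogonal in $L^2(d\mu)$. $A^2(d\mu)$ is the closure in $L^2(d\mu)$ of the linear span of the monomials $z^\alpha$, $\alpha\in\mathbb{N}^n$. $A^2_{(0,1)}(d\mu)$ is the Hilbert space of $(0,1)$-forms $\sum_{j=1}^n f_j\,d\bar z_j$ with $f_j\in A^2(d\mu)$, with norm squared $\sum_j\|f_j\|^2_{L^2(d\mu)}$. Canonical solution operator $S$: $S\omega$ is the solution $f\in L^2(d\mu)$ of $\bar\partial f=\omega$ that is orthogonal to $A^2(d\mu)$. Concretely, since $\bar\partial(\bar z_j z^\alpha)=z^\alpha d\bar z_j$, on the dense subspace of forms with polynomial coefficients (finite linear combinations of the $z^\alpha d\bar z_j$) $S$ is the linear map for which $S(z^\alpha d\bar z_j)$ is the unique element of $\bar z_j z^\alpha+A^2(d\mu)$ orthogonal to $A^2(d\mu)$. "Compact" means that this densely defined map extends to a compact operator $A^2_{(0,1)}(d\mu)\to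 L^2(d\mu)$. *)

theory Defs
  imports "HOL-Analysis.Analysis"
begin

definition unitary_matrix :: "complex^'n^'n \<Rightarrow> bool" where
  "unitary_matrix U \<longleftrightarrow>
     (\<chi> i j. cnj (U $ j $ i)) ** U = mat 1 \<and> U ** (\<chi> i j. cnj (U $ j $ i)) = mat 1"

definition rotation_invariant :: "(complex^'n) measure \<Rightarrow> bool" where
  "rotation_invariant \<mu> \<longleftrightarrow> (\<forall>U. unitary_matrix U \<longrightarrow> distr \<mu> \<mu> (\<lambda>z. U *v z) = \<mu>)"

(* The Bochner integral is 0 for a non-integrable function, so statements about the
   moments carry a separate integrability hypothesis. *)
definition moment :: "(complex^'n) measure \<Rightarrow> nat \<Rightarrow> real" where
  "moment \<mu> d = (LINT z|\<mu>. norm z ^ (2 * d))"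

(* The elements of L^2 are represented by square-integrable functions; two of them are
   the same element if they agree almost everywhere. *)

definition L2 :: "'a measure \<Rightarrow> ('a \<Rightarrow> complex) set" where
  "L2 \<mu> = {f \<in> borel_measurable \<mu>. integrable \<mu> (\<lambda>z. (cmod (f z))\<^sup>2)}"

definition L2_inner :: "'a measure \<Rightarrow> ('a \<Rightarrow> complex) \<Rightarrow> ('a \<Rightarrow> complex) \<Rightarrow> complex" where
  "L2_inner \<mu> f g = (LINT z|\<mu>. f z * cnj (g z))"

definition L2_norm :: "'a measure \<Rightarrow> ('a \<Rightarrow> complex) \<Rightarrow> real" where
  "L2_norm \<mu> f = sqrt (LINT z|\<mu>. (cmod (f z))\<^sup>2)"

definition monomial :: "('n::finite \<Rightarrow> nat) \<Rightarrow> complex^'n \<Rightarrow> complex" where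
  "monomial \<alpha> z = (\<Prod>j\<in>UNIV. (z $ j) ^ \<alpha> j)"

definition polynomials :: "(complex^'n \<Rightarrow> complex) set" where
  "polynomials = {p. \<exists>A c. finite A \<and> p = (\<lambda>z. \<Sum>\<alpha>\<in>A. c \<alpha> * monomial \<alpha> z)}"

definition A2 :: "(complex^'n) measure \<Rightarrow> (complex^'n \<Rightarrow> complex) set" where
  "A2 \<mu> = {f \<in> L2 \<mu>. \<forall>e>0. \<exists>p\<in>polynomials. p \<in> L2 \<mu> \<and> L2_norm \<mu> (\<lambda>z. f z - p z) < e}"

(* The (0,1)-form with coefficient f_j at d zbar_j is represented by its family of
   coefficients. *)
type_synonym 'n form01 = "'n \<Rightarrow> complex^'n \<Rightarrow> complex"

definition A2_form01 :: "(complex^'n) measure \<Rightarrow> 'n form01 set" where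
  "A2_form01 \<mu> = {\<omega>. \<forall>j. \<omega> j \<in> A2 \<mu>}"

definition form01_norm :: "(complex^'n) measure \<Rightarrow> 'n form01 \<Rightarrow> real" where
  "form01_norm \<mu> \<omega> = sqrt (\<Sum>j\<in>UNIV. (L2_norm \<mu> (\<omega> j))\<^sup>2)"

definition polynomial_form01 :: "'n::finite form01 set" where
  "polynomial_form01 = {\<omega>. \<forall>j. \<omega> j \<in> polynomials}"

definition monomial_form01 :: "('n::finite \<Rightarrow> nat) \<Rightarrow> 'n \<Rightarrow> 'n form01" where
  "monomial_form01 \<alpha> j = (\<lambda>k z. if k = j then monomial \<alpha> z else 0)"

(* Linear maps into L^2, well defined on almost-everywhere classes. *)
definition linear_form01_operator ::
  "(complex^'n) measure \<Rightarrow> 'n form01 set \<Rightarrow> ('n form01 \<Rightarrow> complex^'n \<Rightarrow> complex) \<Rightarrow> bool" where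
  "linear_form01_operator \<mu> D T \<longleftrightarrow>
     (\<forall>\<omega>\<in>D. T \<omega> \<in> L2 \<mu>) \<and>
     (\<forall>\<omega>\<in>D. \<forall>\<eta>\<in>D. (\<forall>j. AE z in \<mu>. \<omega> j z = \<eta> j z) \<longrightarrow> (AE z in \<mu>. T \<omega> z = T \<eta> z)) \<and>
     (\<forall>\<omega>\<in>D. \<forall>\<eta>\<in>D. \<forall>a b. AE z in \<mu>.
        T (\<lambda>j z. a * \<omega> j z + b * \<eta> j z) z = a * T \<omega> z + b * T \<eta> z)"

definition compact_form01_operator ::
  "(complex^'n) measure \<Rightarrow> ('n form01 \<Rightarrow> complex^'n \<Rightarrow> complex) \<Rightarrow> bool" where
  "compact_form01_operator \<mu> T \<longleftrightarrow>
     linear_form01_operator \<mu> (A2_form01 \<mu>) T \<and>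
     (\<forall>W :: nat \<Rightarrow> 'n form01. \<forall>B.
        (\<forall>k. W k \<in> A2_form01 \<mu> \<and> form01_norm \<mu> (W k) \<le> B) \<longrightarrow>
        (\<exists>r g. strict_mono r \<and> g \<in> L2 \<mu> \<and>
           (\<lambda>k. L2_norm \<mu> (\<lambda>z. T (W (r k)) z - g z)) \<longlonglongrightarrow> 0))"

(* zbar_j z^alpha is one solution of dbar f = z^alpha d zbar_j; the canonical solution
   is the representative of zbar_j z^alpha + A^2 that is orthogonal to A^2. These
   conditions, with linearity, determine S on polynomial forms up to almost-everywhere
   equality. *)
definition canonical_solution_operator ::
  "(complex^'n) measure \<Rightarrow> ('n form01 \<Rightarrow> complex^'n \<Rightarrow> complex) \<Rightarrow> bool" where
  "canonical_solution_operator \<mu> S \<longleftrightarrow>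
     linear_form01_operator \<mu> polynomial_form01 S \<and>
     (\<forall>\<alpha> j. (\<lambda>z. S (monomial_form01 \<alpha> j) z - cnj (z $ j) * monomial \<alpha> z) \<in> A2 \<mu> \<and>
            (\<forall>g\<in>A2 \<mu>. L2_inner \<mu> (S (monomial_form01 \<alpha> j)) g = 0))"

definition canonical_solution_operator_compact :: "(complex^'n) measure \<Rightarrow> bool" where
  "canonical_solution_operator_compact \<mu> \<longleftrightarrow>
     (\<exists>S T. canonical_solution_operator \<mu> S \<and> compact_form01_operator \<mu> T \<and>
        (\<forall>\<omega>\<in>polynomial_form01. AE z in \<mu>. T \<omega> z = S \<omega> z))"

end

theory Submission
  imports Defs "HOL-Complex_Analysis.Great_Picard"
begin

text \<open>
  Write \<open>n\<close> for the dimension, \<open>|\<alpha>|\<close> for the degree of a multi-index, \<open>e\<^sub>j\<close> for the unit vectors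
  and \<open>*\<close> for complex conjugation. Rotation invariance makes the monomials orthogonal and fixes
  their norms in terms of the moments (\<open>weighted_inner_self\<close>):
  \<open>\<parallel>z\<^sup>\<alpha>\<parallel>\<^sup>2 = \<alpha>! m\<^sub>d / (n (n + 1) \<cdots> (n + d - 1))\<close> for \<open>d = |\<alpha>|\<close>. Hence the canonical solution for
  \<open>z\<^sup>\<alpha> dz\<^sub>j\<^sup>*\<close> is explicit, namely \<open>z\<^sub>j\<^sup>* z\<^sup>\<alpha>\<close> minus a multiple of \<open>z\<^sup>\<alpha> / z\<^sub>j\<close>, and so is its norm.

  The solutions for \<open>z\<^sup>\<alpha> dz\<^sub>j\<^sup>*\<close> and \<open>z\<^sup>\<beta> dz\<^sub>k\<^sup>*\<close> are orthogonal unless \<open>\<alpha> - e\<^sub>j = \<beta> - e\<^sub>k\<close>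
  (\<open>canonical_solution_orthogonal\<close>). So \<open>S\<^sup>*S\<close> is an orthogonal sum of blocks of size at most \<open>n\<close>,
  indexed by \<open>\<gamma> = \<alpha> - e\<^sub>j\<close>. If \<open>\<gamma>\<close> has no negative entry and \<open>|\<gamma>| = d - 1\<close>, then the trace of the
  block, the sum over \<open>j\<close> of the quotients of squared norms of solution and form, depends on
  \<open>d\<close> only and is exactly the expression whose limit is taken in the theorem
  (\<open>sum_solution_ratio\<close>, \<open>block_trace_eq_moments\<close>). If \<open>\<gamma>\<close> has a negative entry, the block is
  one-dimensional, and for \<open>d > 0\<close> log-convexity of the moments bounds it by the same trace.
  Since the blocks are positive of bounded size, their norms tend to zero if and only if their traces
  do.

  If the traces tend to zero, they bound the norms of the blocks (\<open>solution_sum_le\<close>), so \<open>S\<close> extends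
  to a norm limit of finite-rank operators (\<open>solution_operator_compact_sequence\<close>); the limits exist by
  the Riesz-Fischer theorem (\<open>L2_complete\<close>). Conversely, fix \<open>j\<close>. The normalised forms
  \<open>z\<^sup>\<alpha> dz\<^sub>j\<^sup>*\<close> are orthonormal with orthogonal images, so a compact \<open>S\<close> sends every sequence of
  distinct ones to a null sequence (\<open>compact_imp_solution_ratio_null\<close>); summing over \<open>j\<close> along a
  sequence of blocks gives the limit of the traces.
\<close>

section \<open>Square-integrable functions and null sequences\<close>

lemma borel_measurable_cnj [measurable (raw)]:
  "f \<in> borel_measurable M \<Longrightarrow> (\<lambda>z. cnj (f z)) \<in> borel_measurable M"
  by (rule borel_measurable_continuous_on[OF continuous_on_cnj[OF continuous_on_id]])

lemma L2_measurable [measurable_dest]: "f \<in> L2 M \<Longrightarrow> f \<in> borel_measurable M"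
  by (simp add: L2_def)

lemma L2_integrable_square: "f \<in> L2 M \<Longrightarrow> integrable M (\<lambda>z. (cmod (f z))\<^sup>2)"
  by (simp add: L2_def)

lemma L2_integrable_mult:
  assumes "f \<in> L2 M" "g \<in> L2 M"
  shows "integrable M (\<lambda>z. f z * cnj (g z))"
proof (rule Bochner_Integration.integrable_bound)
  show "integrable M (\<lambda>z. (cmod (f z))\<^sup>2 + (cmod (g z))\<^sup>2)"
    using assms by (intro Bochner_Integration.integrable_add L2_integrable_square)
  show "(\<lambda>z. f z * cnj (g z)) \<in> borel_measurable M"
    using assms[THEN L2_measurable] by measurable
  have "a * b \<le> a\<^sup>2 + b\<^sup>2" if "a \<ge> 0" "b \<ge> 0" for a b :: real
    using sum_squares_bound[of a b] that mult_nonneg_nonneg[OF that] by linarith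
  then show "AE z in M. norm (f z * cnj (g z)) \<le> norm ((cmod (f z))\<^sup>2 + (cmod (g z))\<^sup>2)"
    by (auto simp: norm_mult)
qed

lemma L2_scale: "f \<in> L2 M \<Longrightarrow> (\<lambda>z. a * f z) \<in> L2 M"
  by (auto simp: L2_def norm_mult power_mult_distrib)

lemma L2_add:
  assumes "f \<in> L2 M" "g \<in> L2 M"
  shows "(\<lambda>z. f z + g z) \<in> L2 M"
proof -
  have "integrable M (\<lambda>z. (cmod (f z + g z))\<^sup>2)"
  proof (rule Bochner_Integration.integrable_bound)
    show "integrable M (\<lambda>z. 2 * (cmod (f z))\<^sup>2 + 2 * (cmod (g z))\<^sup>2)"
      using assms by (intro Bochner_Integration.integrable_add integrable_mult_right L2_integrable_square)
    show "(\<lambda>z. (cmod (f z + g z))\<^sup>2) \<in> borel_measurable M"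
      using assms[THEN L2_measurable] by measurable
    have "(cmod (a + b))\<^sup>2 \<le> 2 * (cmod a)\<^sup>2 + 2 * (cmod b)\<^sup>2" for a b
    proof -
      have "(cmod (a + b))\<^sup>2 \<le> (cmod a + cmod b)\<^sup>2"
        by (intro power_mono norm_triangle_ineq) auto
      also have "\<dots> \<le> 2 * (cmod a)\<^sup>2 + 2 * (cmod b)\<^sup>2"
        using sum_squares_bound[of "cmod a" "cmod b"] by (simp add: power2_sum)
      finally show ?thesis .
    qed
    then show "AE z in M. norm ((cmod (f z + g z))\<^sup>2) \<le> norm (2 * (cmod (f z))\<^sup>2 + 2 * (cmod (g z))\<^sup>2)"
      by auto
  qed
  then show ?thesis
    using assms by (auto simp: L2_def)
qed

lemma L2_zero: "(\<lambda>z. 0) \<in> L2 M"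
  by (simp add: L2_def)

lemma L2_diff: "f \<in> L2 M \<Longrightarrow> g \<in> L2 M \<Longrightarrow> (\<lambda>z. f z - g z) \<in> L2 M"
  using L2_add[of f M "\<lambda>z. (-1) * g z"] L2_scale[of g M "-1"] by simp

lemma L2_sum: "(\<And>i. i \<in> I \<Longrightarrow> f i \<in> L2 M) \<Longrightarrow> (\<lambda>z. \<Sum>i\<in>I. f i z) \<in> L2 M"
  by (induction I rule: infinite_finite_induct) (auto intro: L2_add L2_zero)

lemma L2_inner_cnj: "cnj (L2_inner M f g) = L2_inner M g f"
proof -
  have "cnj (L2_inner M f g) = (LINT z|M. cnj (f z * cnj (g z)))"
    unfolding L2_inner_def by (rule Bochner_Integration.integral_cnj[symmetric])
  then show ?thesis by (simp add: L2_inner_def mult.commute)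
qed

lemma L2_inner_eq_0_commute: "L2_inner M f g = 0 \<longleftrightarrow> L2_inner M g f = 0"
  by (metis L2_inner_cnj complex_cnj_zero_iff)

lemma L2_inner_add_left:
  "f \<in> L2 M \<Longrightarrow> g \<in> L2 M \<Longrightarrow> h \<in> L2 M \<Longrightarrow>
    L2_inner M (\<lambda>z. f z + g z) h = L2_inner M f h + L2_inner M g h"
  unfolding L2_inner_def by (simp add: distrib_right L2_integrable_mult)

lemma L2_inner_diff_left:
  "f \<in> L2 M \<Longrightarrow> g \<in> L2 M \<Longrightarrow> h \<in> L2 M \<Longrightarrow>
    L2_inner M (\<lambda>z. f z - g z) h = L2_inner M f h - L2_inner M g h"
  unfolding L2_inner_def by (simp add: left_diff_distrib L2_integrable_mult)

lemma L2_inner_scale_left: "L2_inner M (\<lambda>z. a * f z) h = a * L2_inner M f h"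
  unfolding L2_inner_def by (simp add: mult.assoc)

lemma L2_inner_sum_left:
  "(\<And>i. i \<in> I \<Longrightarrow> f i \<in> L2 M) \<Longrightarrow> h \<in> L2 M \<Longrightarrow>
    L2_inner M (\<lambda>z. \<Sum>i\<in>I. f i z) h = (\<Sum>i\<in>I. L2_inner M (f i) h)"
  unfolding L2_inner_def by (simp add: sum_distrib_right L2_integrable_mult)

lemma L2_inner_sum_right:
  assumes "\<And>i. i \<in> I \<Longrightarrow> f i \<in> L2 M" "h \<in> L2 M"
  shows "L2_inner M h (\<lambda>z. \<Sum>i\<in>I. f i z) = (\<Sum>i\<in>I. L2_inner M h (f i))"
proof -
  have "L2_inner M h (\<lambda>z. \<Sum>i\<in>I. f i z) = cnj (\<Sum>i\<in>I. L2_inner M (f i) h)"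
    by (simp add: assms L2_inner_sum_left flip: L2_inner_cnj[of M "\<lambda>z. \<Sum>i\<in>I. f i z"])
  then show ?thesis by (simp add: L2_inner_cnj)
qed

lemma L2_inner_diff_right:
  assumes "f \<in> L2 M" "g \<in> L2 M" "h \<in> L2 M"
  shows "L2_inner M h (\<lambda>z. f z - g z) = L2_inner M h f - L2_inner M h g"
proof -
  have "cnj (L2_inner M (\<lambda>z. f z - g z) h) = cnj (L2_inner M f h) - cnj (L2_inner M g h)"
    by (simp add: assms L2_inner_diff_left)
  then show ?thesis by (simp only: L2_inner_cnj)
qed

lemma L2_inner_scale_right: "L2_inner M h (\<lambda>z. a * f z) = cnj a * L2_inner M h f"
proof -
  have "cnj (L2_inner M (\<lambda>z. a * f z) h) = cnj a * cnj (L2_inner M f h)"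
    by (simp add: L2_inner_scale_left)
  then show ?thesis by (simp only: L2_inner_cnj)
qed

lemma L2_norm_nonneg: "0 \<le> L2_norm M f"
  by (simp add: L2_norm_def)

lemma L2_norm_power2: "(L2_norm M f)\<^sup>2 = (LINT z|M. (cmod (f z))\<^sup>2)"
  by (simp add: L2_norm_def)

lemma L2_inner_self: "L2_inner M f f = of_real ((L2_norm M f)\<^sup>2)"
proof -
  have "L2_inner M f f = (LINT z|M. complex_of_real ((cmod (f z))\<^sup>2))"
    unfolding L2_inner_def by (intro Bochner_Integration.integral_cong refl complex_norm_square[symmetric])
  then show ?thesis by (simp add: L2_norm_power2 del: of_real_power)
qed

lemma L2_norm_cong_AE:
  assumes "f \<in> borel_measurable M" "g \<in> borel_measurable M" "AE z in M. f z = g z"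
  shows "L2_norm M f = L2_norm M g"
proof -
  have "(LINT z|M. (cmod (f z))\<^sup>2) = (LINT z|M. (cmod (g z))\<^sup>2)"
    using assms by (intro integral_cong_AE) (measurable, auto)
  then show ?thesis by (simp add: L2_norm_def)
qed

lemma L2_inner_cong_AE:
  assumes "f \<in> borel_measurable M" "f' \<in> borel_measurable M" "g \<in> borel_measurable M"
    and "AE z in M. f z = f' z"
  shows "L2_inner M f g = L2_inner M f' g"
proof -
  note [measurable] = assms(1-3)
  show ?thesis
    unfolding L2_inner_def using assms(4) by (intro integral_cong_AE) auto
qed

lemma L2_norm_scale: "L2_norm M (\<lambda>z. a * f z) = cmod a * L2_norm M f"
  by (simp add: L2_norm_def norm_mult power_mult_distrib real_sqrt_mult)

lemma L2_norm_minus_commute: "L2_norm M (\<lambda>z. f z - g z) = L2_norm M (\<lambda>z. g z - f z)"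
  by (simp add: L2_norm_def norm_minus_commute)

lemma L2_norm_zero: "L2_norm M (\<lambda>z. 0) = 0"
  by (simp add: L2_norm_def)

lemma L2_norm_eq_0_AE:
  assumes "f \<in> L2 M" "L2_norm M f = 0"
  shows "AE z in M. f z = 0"
proof -
  have "(LINT z|M. (cmod (f z))\<^sup>2) = 0"
    using assms(2) by (metis L2_norm_power2 zero_power2)
  then show ?thesis
    using integral_nonneg_eq_0_iff_AE[OF L2_integrable_square[OF assms(1)]] by auto
qed

text \<open>Expanding the square of \<open>\<parallel>g\<parallel> |f| - \<parallel>f\<parallel> |g|\<close>
  gives the Cauchy-Schwarz inequality for the absolute values.\<close>

lemma L2_Cauchy_Schwarz_abs:
  assumes f: "f \<in> L2 M" and g: "g \<in> L2 M"
  shows "integrable M (\<lambda>z. cmod (f z) * cmod (g z))"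
    and "(LINT z|M. cmod (f z) * cmod (g z)) \<le> L2_norm M f * L2_norm M g"
proof -
  show int: "integrable M (\<lambda>z. cmod (f z) * cmod (g z))"
    using integrable_norm[OF L2_integrable_mult[OF f g]] by (simp add: norm_mult)
  let ?I = "LINT z|M. cmod (f z) * cmod (g z)"
  let ?a = "L2_norm M f" and ?b = "L2_norm M g"
  show "?I \<le> ?a * ?b"
  proof (cases "?a * ?b = 0")
    case True
    then have "AE z in M. cmod (f z) * cmod (g z) = 0"
      using L2_norm_eq_0_AE[OF f] L2_norm_eq_0_AE[OF g] by auto
    then have "?I = 0"
      by (rule integral_eq_zero_AE)
    with True show ?thesis by linarith
  next
    case False
    then have pos: "?a * ?b > 0"
      using L2_norm_nonneg[of M f] L2_norm_nonneg[of M g] by (simp add: less_le)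
    have "0 \<le> (LINT z|M. (?b * cmod (f z) - ?a * cmod (g z))\<^sup>2)"
      by simp
    also have "\<dots> = (LINT z|M. ?b\<^sup>2 * (cmod (f z))\<^sup>2 + ?a\<^sup>2 * (cmod (g z))\<^sup>2 -
        2 * ?a * ?b * (cmod (f z) * cmod (g z)))"
      by (intro Bochner_Integration.integral_cong) (auto simp: power2_eq_square algebra_simps)
    also have "\<dots> = ?b\<^sup>2 * ?a\<^sup>2 + ?a\<^sup>2 * ?b\<^sup>2 - 2 * ?a * ?b * ?I"
      using f g int by (simp add: L2_integrable_square L2_norm_power2)
    finally have "(?a * ?b) * ?I \<le> (?a * ?b) * (?a * ?b)"
      by (simp add: power2_eq_square algebra_simps)
    with pos show ?thesis
      by (simp add: mult_le_cancel_left)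
  qed
qed

lemma L2_norm_triangle:
  assumes f: "f \<in> L2 M" and g: "g \<in> L2 M"
  shows "L2_norm M (\<lambda>z. f z + g z) \<le> L2_norm M f + L2_norm M g"
proof -
  have "(L2_norm M (\<lambda>z. f z + g z))\<^sup>2 \<le>
      (LINT z|M. (cmod (f z))\<^sup>2 + (cmod (g z))\<^sup>2 + 2 * (cmod (f z) * cmod (g z)))"
    unfolding L2_norm_power2
  proof (rule integral_mono)
    show "integrable M (\<lambda>z. (cmod (f z + g z))\<^sup>2)"
      using L2_add[OF f g] by (rule L2_integrable_square)
    show "integrable M (\<lambda>z. (cmod (f z))\<^sup>2 + (cmod (g z))\<^sup>2 + 2 * (cmod (f z) * cmod (g z)))"
      using f g L2_Cauchy_Schwarz_abs(1)[OF f g] by (simp add: L2_integrable_square)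
    fix z
    have "(cmod (f z + g z))\<^sup>2 \<le> (cmod (f z) + cmod (g z))\<^sup>2"
      by (intro power_mono norm_triangle_ineq) auto
    then show "(cmod (f z + g z))\<^sup>2 \<le> (cmod (f z))\<^sup>2 + (cmod (g z))\<^sup>2 + 2 * (cmod (f z) * cmod (g z))"
      by (simp add: power2_sum)
  qed
  also have "\<dots> \<le> (L2_norm M f + L2_norm M g)\<^sup>2"
    using f g L2_Cauchy_Schwarz_abs[OF f g]
    by (simp add: L2_integrable_square L2_norm_power2 power2_sum)
  finally show ?thesis
    by (rule power2_le_imp_le) (simp add: L2_norm_nonneg)
qed

lemma L2_norm_triangle_diff:
  assumes "f \<in> L2 M" "g \<in> L2 M" "h \<in> L2 M"
  shows "L2_norm M (\<lambda>z. f z - h z) \<le> L2_norm M (\<lambda>z. f z - g z) + L2_norm M (\<lambda>z. g z - h z)"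
  using L2_norm_triangle[of "\<lambda>z. f z - g z" M "\<lambda>z. g z - h z"] assms by (simp add: L2_diff)

lemma L2_norm_sum_le:
  "(\<And>i. i \<in> I \<Longrightarrow> f i \<in> L2 M) \<Longrightarrow> L2_norm M (\<lambda>z. \<Sum>i\<in>I. f i z) \<le> (\<Sum>i\<in>I. L2_norm M (f i))"
proof (induction I rule: infinite_finite_induct)
  case (insert i I)
  then have "L2_norm M (\<lambda>z. f i z + (\<Sum>i\<in>I. f i z)) \<le> L2_norm M (f i) + L2_norm M (\<lambda>z. \<Sum>i\<in>I. f i z)"
    by (intro L2_norm_triangle L2_sum) auto
  with insert show ?case by (auto intro: order_trans)
qed (auto simp: L2_norm_zero)

lemma L2_Cauchy_Schwarz:
  assumes f: "f \<in> L2 M" and g: "g \<in> L2 M"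
  shows "cmod (L2_inner M f g) \<le> L2_norm M f * L2_norm M g"
proof -
  have "cmod (L2_inner M f g) \<le> (LINT z|M. cmod (f z) * cmod (g z))"
    unfolding L2_inner_def using integral_norm_bound[of M "\<lambda>z. f z * cnj (g z)"]
    by (simp add: norm_mult)
  also note L2_Cauchy_Schwarz_abs(2)[OF f g]
  finally show ?thesis .
qed

lemma L2_norm_orthogonal_sum:
  assumes "finite I" and L2: "\<And>i. i \<in> I \<Longrightarrow> f i \<in> L2 M"
    and orth: "\<And>i j. i \<in> I \<Longrightarrow> j \<in> I \<Longrightarrow> i \<noteq> j \<Longrightarrow> L2_inner M (f i) (f j) = 0"
  shows "(L2_norm M (\<lambda>z. \<Sum>i\<in>I. f i z))\<^sup>2 = (\<Sum>i\<in>I. (L2_norm M (f i))\<^sup>2)"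
proof -
  have "complex_of_real ((L2_norm M (\<lambda>z. \<Sum>i\<in>I. f i z))\<^sup>2) =
      (\<Sum>i\<in>I. \<Sum>j\<in>I. L2_inner M (f i) (f j))"
    unfolding L2_inner_self[symmetric]
    by (simp add: L2 L2_sum L2_inner_sum_left L2_inner_sum_right)
  also have "\<dots> = (\<Sum>i\<in>I. \<Sum>j\<in>I. if j = i then L2_inner M (f i) (f i) else 0)"
    by (intro sum.cong refl) (auto simp: orth)
  also have "\<dots> = (\<Sum>i\<in>I. L2_inner M (f i) (f i))"
    using assms(1) by (intro sum.cong) auto
  also have "\<dots> = complex_of_real (\<Sum>i\<in>I. (L2_norm M (f i))\<^sup>2)"
    by (simp add: L2_inner_self)
  finally show ?thesis
    using of_real_eq_iff by blast
qed

lemma L2_norm_diff_orthogonal: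
  assumes f: "f \<in> L2 M" and g: "g \<in> L2 M" and "L2_inner M f g = 0"
  shows "(L2_norm M (\<lambda>z. f z - g z))\<^sup>2 = (L2_norm M f)\<^sup>2 + (L2_norm M g)\<^sup>2"
proof -
  have "L2_inner M g f = 0"
    using assms(3) L2_inner_eq_0_commute by blast
  then have "complex_of_real ((L2_norm M (\<lambda>z. f z - g z))\<^sup>2) = L2_inner M f f + L2_inner M g g"
    unfolding L2_inner_self[symmetric]
    by (simp add: f g assms(3) L2_diff L2_inner_diff_left L2_inner_diff_right)
  also have "\<dots> = complex_of_real ((L2_norm M f)\<^sup>2 + (L2_norm M g)\<^sup>2)"
    by (simp add: L2_inner_self)
  finally show ?thesis
    using of_real_eq_iff by blast
qed

lemma L2_norm_tendsto:
  assumes "\<And>k. F k \<in> L2 M" "g \<in> L2 M" "(\<lambda>k. L2_norm M (\<lambda>z. F k z - g z)) \<longlonglongrightarrow> 0"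
  shows "(\<lambda>k. L2_norm M (F k)) \<longlonglongrightarrow> L2_norm M g"
proof -
  have "norm (L2_norm M (F k) - L2_norm M g) \<le> L2_norm M (\<lambda>z. F k z - g z)" for k
    using L2_norm_triangle[of "\<lambda>z. F k z - g z" M g] L2_norm_triangle[of "\<lambda>z. g z - F k z" M "F k"]
      assms(1)[of k] assms(2)
    by (simp add: L2_diff L2_norm_minus_commute[of M g])
  then have "(\<lambda>k. L2_norm M (F k) - L2_norm M g) \<longlonglongrightarrow> 0"
    by (intro Lim_null_comparison[OF always_eventually assms(3)] allI)
  then show ?thesis
    by (simp add: LIM_zero_iff)
qed

text \<open>The Riesz-Fischer theorem. For a finite measure the distances of a rapidly converging
  subsequence are summable in \<open>L\<^sup>1\<close>, so that the subsequence converges almost everywhere;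
  Fatou's lemma transfers the Cauchy estimates to the pointwise limit.\<close>

lemma L2_complete:
  fixes F :: "nat \<Rightarrow> 'a \<Rightarrow> complex"
  assumes fin: "finite_measure M" and F: "\<And>k. F k \<in> L2 M"
    and Cauchy: "\<And>e. e > 0 \<Longrightarrow> \<exists>N. \<forall>k\<ge>N. \<forall>l\<ge>N. L2_norm M (\<lambda>z. F k z - F l z) < e"
  obtains g where "g \<in> L2 M" "(\<lambda>k. L2_norm M (\<lambda>z. F k z - g z)) \<longlonglongrightarrow> 0"
proof -
  interpret finite_measure M by (rule fin)
  have one: "(\<lambda>z. 1) \<in> L2 M"
    by (simp add: L2_def)
  have "\<exists>N. \<forall>k\<ge>N. \<forall>l\<ge>N. L2_norm M (\<lambda>z. F k z - F l z) < (1/2) ^ i" for i :: nat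
    by (rule Cauchy) simp
  then obtain N where N: "\<And>i k l. k \<ge> N i \<Longrightarrow> l \<ge> N i \<Longrightarrow> L2_norm M (\<lambda>z. F k z - F l z) < (1/2) ^ i"
    by metis
  \<comment> \<open>indices at which the distances drop below the powers of \<open>1/2\<close>\<close>
  define r where "r = rec_nat (N 0) (\<lambda>i p. max (Suc p) (N (Suc i)))"
  have rN: "r i \<ge> N i" for i
    by (cases i) (auto simp: r_def)
  have rmono: "strict_mono r"
    by (rule strict_monoI_Suc) (simp add: r_def less_max_iff_disj)
  have step: "L2_norm M (\<lambda>z. F (r (Suc i)) z - F (r i) z) \<le> (1/2) ^ i" for i
  proof -
    have "r (Suc i) \<ge> N i"
      using rN[of i] rmono by (metis le_trans less_or_eq_imp_le lessI strict_monoD)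
    from N[OF this rN[of i]] show ?thesis by simp
  qed
  define D where "D i z = cmod (F (r (Suc i)) z - F (r i) z)" for i z
  have D_int: "integrable M (D i)" and D_le: "(LINT z|M. D i z) \<le> (1/2) ^ i * L2_norm M (\<lambda>z. 1)" for i
  proof -
    have L: "(\<lambda>z. F (r (Suc i)) z - F (r i) z) \<in> L2 M"
      by (intro L2_diff F)
    show "integrable M (D i)"
      using L2_Cauchy_Schwarz_abs(1)[OF L one] by (simp add: D_def[abs_def])
    have "(LINT z|M. D i z) \<le> L2_norm M (\<lambda>z. F (r (Suc i)) z - F (r i) z) * L2_norm M (\<lambda>z. 1)"
      using L2_Cauchy_Schwarz_abs(2)[OF L one] by (simp add: D_def[abs_def])
    also have "\<dots> \<le> (1/2) ^ i * L2_norm M (\<lambda>z. 1)"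
      by (intro mult_right_mono step L2_norm_nonneg)
    finally show "(LINT z|M. D i z) \<le> (1/2) ^ i * L2_norm M (\<lambda>z. 1)" .
  qed
  have [measurable]: "D i \<in> borel_measurable M" for i
    using D_int by blast
  have "(\<integral>\<^sup>+z. (\<Sum>i. ennreal (D i z)) \<partial>M) = (\<Sum>i. \<integral>\<^sup>+z. ennreal (D i z) \<partial>M)"
    by (rule nn_integral_suminf) measurable
  also have "\<dots> = (\<Sum>i. ennreal (LINT z|M. D i z))"
    by (intro suminf_cong nn_integral_eq_integral D_int) (auto simp: D_def)
  also have "\<dots> \<le> (\<Sum>i. ennreal ((1/2) ^ i * L2_norm M (\<lambda>z. 1)))"
    by (intro suminf_le ennreal_leI D_le) auto
  also have "\<dots> = ennreal (\<Sum>i. (1/2) ^ i * L2_norm M (\<lambda>z. 1))"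
    by (intro suminf_ennreal2) (auto simp: L2_norm_nonneg intro!: summable_mult2 summable_geometric)
  finally have "(\<integral>\<^sup>+z. (\<Sum>i. ennreal (D i z)) \<partial>M) \<noteq> \<infinity>"
    using ennreal_less_top leD by (metis infinity_ennreal_def)
  then have "AE z in M. (\<Sum>i. ennreal (D i z)) \<noteq> \<infinity>"
    by (rule nn_integral_PInf_AE[rotated]) measurable
  then have conv: "AE z in M. convergent (\<lambda>i. F (r i) z)"
  proof eventually_elim
    case (elim z)
    then have "summable (\<lambda>i. D i z)"
      by (intro summable_suminf_not_top) (simp_all add: D_def)
    then have "summable (\<lambda>i. F (r (Suc i)) z - F (r i) z)"
      unfolding D_def by (rule summable_norm_cancel)
    then have "convergent (\<lambda>n. \<Sum>i<n. F (r (Suc i)) z - F (r i) z)"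
      by (simp add: summable_iff_convergent)
    then have "convergent (\<lambda>n. F (r n) z - F (r 0) z)"
      using sum_lessThan_telescope[of "\<lambda>i. F (r i) z"] by simp
    then show ?case
      using convergent_diff_const_right_iff by blast
  qed
  define g where "g z = lim (\<lambda>i. F (r i) z)" for z
  have [measurable]: "F k \<in> borel_measurable M" for k
    using F by (rule L2_measurable)
  have g_meas [measurable]: "g \<in> borel_measurable M"
    unfolding g_def[abs_def] by measurable
  have fatou: "(\<integral>\<^sup>+z. ennreal ((cmod (F k z - g z))\<^sup>2) \<partial>M) \<le> ennreal (e\<^sup>2)"
    if e: "e > 0" and k: "\<And>l. l \<ge> k \<Longrightarrow> L2_norm M (\<lambda>z. F k z - F l z) < e" for e k
  proof -
    have "(\<integral>\<^sup>+z. ennreal ((cmod (F k z - g z))\<^sup>2) \<partial>M) =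
        (\<integral>\<^sup>+z. liminf (\<lambda>i. ennreal ((cmod (F k z - F (r i) z))\<^sup>2)) \<partial>M)"
    proof (rule nn_integral_cong_AE, use conv in eventually_elim)
      case (elim z)
      then have "(\<lambda>i. F (r i) z) \<longlonglongrightarrow> g z"
        by (simp add: g_def convergent_LIMSEQ_iff)
      then have "(\<lambda>i. ennreal ((cmod (F k z - F (r i) z))\<^sup>2)) \<longlonglongrightarrow> ennreal ((cmod (F k z - g z))\<^sup>2)"
        by (intro tendsto_intros)
      then show ?case
        by (rule lim_imp_Liminf[OF sequentially_bot, symmetric])
    qed
    also have "\<dots> \<le> liminf (\<lambda>i. \<integral>\<^sup>+z. ennreal ((cmod (F k z - F (r i) z))\<^sup>2) \<partial>M)"
      by (rule nn_integral_liminf) measurable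
    also have "\<dots> \<le> liminf (\<lambda>i::nat. ennreal (e\<^sup>2))"
    proof (rule Liminf_mono, rule eventually_sequentiallyI[of k])
      fix i assume "i \<ge> k"
      then have "r i \<ge> k"
        using seq_suble[OF rmono, of i] by linarith
      then have "(L2_norm M (\<lambda>z. F k z - F (r i) z))\<^sup>2 \<le> e\<^sup>2"
        using k[of "r i"] by (intro power_mono) (auto simp: L2_norm_nonneg)
      moreover have "(\<integral>\<^sup>+z. ennreal ((cmod (F k z - F (r i) z))\<^sup>2) \<partial>M) =
          ennreal ((L2_norm M (\<lambda>z. F k z - F (r i) z))\<^sup>2)"
        unfolding L2_norm_power2
        by (intro nn_integral_eq_integral L2_integrable_square L2_diff F) auto
      ultimately show "(\<integral>\<^sup>+z. ennreal ((cmod (F k z - F (r i) z))\<^sup>2) \<partial>M) \<le> ennreal (e\<^sup>2)"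
        by (simp add: ennreal_leI)
    qed
    also have "\<dots> = ennreal (e\<^sup>2)"
      by (simp add: Liminf_const)
    finally show ?thesis .
  qed
  have diff_L2: "(\<lambda>z. F k z - g z) \<in> L2 M" and diff_le: "L2_norm M (\<lambda>z. F k z - g z) \<le> e"
    if "e > 0" "\<And>l. l \<ge> k \<Longrightarrow> L2_norm M (\<lambda>z. F k z - F l z) < e" for e k
  proof -
    note * = fatou[OF that]
    have int: "integrable M (\<lambda>z. (cmod (F k z - g z))\<^sup>2)"
    proof (rule integrableI_bounded)
      show "(\<integral>\<^sup>+z. ennreal (norm ((cmod (F k z - g z))\<^sup>2)) \<partial>M) < \<infinity>"
        using le_less_trans[OF * ennreal_less_top] by simp
    qed measurable
    then show "(\<lambda>z. F k z - g z) \<in> L2 M"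
      by (simp add: L2_def)
    have "ennreal (LINT z|M. (cmod (F k z - g z))\<^sup>2) \<le> ennreal (e\<^sup>2)"
      using * nn_integral_eq_integral[OF int] by simp
    then have "(L2_norm M (\<lambda>z. F k z - g z))\<^sup>2 \<le> e\<^sup>2"
      by (simp add: L2_norm_power2 ennreal_le_iff)
    then show "L2_norm M (\<lambda>z. F k z - g z) \<le> e"
      by (rule power2_le_imp_le) (use that(1) in simp)
  qed
  have "g \<in> L2 M"
  proof -
    have "(\<lambda>z. F (N 0) z - g z) \<in> L2 M"
      by (rule diff_L2[where e = 1]) (use N[of 0 "N 0"] in auto)
    from L2_diff[OF F[of "N 0"] this] show ?thesis by simp
  qed
  moreover have "(\<lambda>k. L2_norm M (\<lambda>z. F k z - g z)) \<longlonglongrightarrow> 0"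
  proof (rule LIMSEQ_I)
    fix e :: real assume "e > 0"
    then obtain K where K: "\<forall>k\<ge>K. \<forall>l\<ge>K. L2_norm M (\<lambda>z. F k z - F l z) < e / 2"
      using Cauchy[of "e / 2"] by auto
    have "norm (L2_norm M (\<lambda>z. F k z - g z) - 0) < e" if "k \<ge> K" for k
      using diff_le[of "e / 2" k] K that \<open>e > 0\<close> by (auto simp: L2_norm_nonneg)
    then show "\<exists>K. \<forall>k\<ge>K. norm (L2_norm M (\<lambda>z. F k z - g z) - 0) < e"
      by blast
  qed
  ultimately show ?thesis
    by (rule that)
qed

lemma L2_limit_unique_AE:
  assumes F: "\<And>k. F k \<in> L2 M" and g: "g \<in> L2 M" and h: "h \<in> L2 M"
    and Fg: "(\<lambda>k. L2_norm M (\<lambda>z. F k z - g z)) \<longlonglongrightarrow> 0"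
    and Fh: "(\<lambda>k. L2_norm M (\<lambda>z. F k z - h z)) \<longlonglongrightarrow> 0"
  shows "AE z in M. g z = h z"
proof -
  have "L2_norm M (\<lambda>z. g z - h z) \<le> L2_norm M (\<lambda>z. F k z - g z) + L2_norm M (\<lambda>z. F k z - h z)" for k
    using L2_norm_triangle_diff[OF g F[of k] h] by (simp add: L2_norm_minus_commute[of M g])
  then have "L2_norm M (\<lambda>z. g z - h z) \<le> 0 + 0"
    by (intro LIMSEQ_le_const[OF tendsto_add[OF Fg Fh]] exI[of _ 0] allI impI)
  then have "L2_norm M (\<lambda>z. g z - h z) = 0"
    using L2_norm_nonneg[of M "\<lambda>z. g z - h z"] by linarith
  from L2_norm_eq_0_AE[OF L2_diff[OF g h] this] show ?thesis
    by simp
qed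

text \<open>Orthogonal vectors \<open>u, v\<close> satisfy \<open>\<parallel>u\<parallel> \<le> \<parallel>u - v\<parallel>\<close>.\<close>

lemma orthogonal_convergent_imp_null:
  assumes u: "\<And>k. u k \<in> L2 M" and g: "g \<in> L2 M"
    and orth: "\<And>k l. k \<noteq> l \<Longrightarrow> L2_inner M (u k) (u l) = 0"
    and lim: "(\<lambda>k. L2_norm M (\<lambda>z. u k z - g z)) \<longlonglongrightarrow> 0"
  shows "(\<lambda>k. L2_norm M (u k)) \<longlonglongrightarrow> 0"
proof (rule tendsto_sandwich[where f = "\<lambda>_. 0"])
  have "L2_norm M (u k) \<le> L2_norm M (\<lambda>z. u k z - g z) + L2_norm M (\<lambda>z. u (Suc k) z - g z)" for k
  proof -
    have "(L2_norm M (u k))\<^sup>2 \<le> (L2_norm M (\<lambda>z. u k z - u (Suc k) z))\<^sup>2"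
      using L2_norm_diff_orthogonal[OF u u orth, of k "Suc k"] by simp
    then have "L2_norm M (u k) \<le> L2_norm M (\<lambda>z. u k z - u (Suc k) z)"
      by (rule power2_le_imp_le) (rule L2_norm_nonneg)
    also have "\<dots> \<le> L2_norm M (\<lambda>z. u k z - g z) + L2_norm M (\<lambda>z. g z - u (Suc k) z)"
      by (intro L2_norm_triangle_diff u g)
    finally show ?thesis
      by (simp only: L2_norm_minus_commute[of M g])
  qed
  then show "\<forall>\<^sub>F k in sequentially. L2_norm M (u k) \<le>
      L2_norm M (\<lambda>z. u k z - g z) + L2_norm M (\<lambda>z. u (Suc k) z - g z)"
    by simp
  show "(\<lambda>k. L2_norm M (\<lambda>z. u k z - g z) + L2_norm M (\<lambda>z. u (Suc k) z - g z)) \<longlonglongrightarrow> 0"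
    using tendsto_add[OF lim LIMSEQ_Suc[OF lim]] by simp
qed (auto simp: L2_norm_nonneg)

text \<open>The form in which compactness, a statement about subsequences, yields full convergence.\<close>

lemma tendsto_zero_subseqI:
  fixes f :: "nat \<Rightarrow> real"
  assumes "\<And>s :: nat \<Rightarrow> nat. strict_mono s \<Longrightarrow> \<exists>r. strict_mono r \<and> (\<lambda>k. f (s (r k))) \<longlonglongrightarrow> 0"
  shows "f \<longlonglongrightarrow> 0"
proof (rule ccontr)
  assume "\<not> f \<longlonglongrightarrow> 0"
  then obtain e where e: "e > 0" "\<And>N. \<exists>n\<ge>N. \<bar>f n\<bar> \<ge> e"
    by (auto simp: LIMSEQ_iff not_less)
  then have inf: "infinite {n. \<bar>f n\<bar> \<ge> e}"
    by (simp add: infinite_nat_iff_unbounded_le)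
  obtain s :: "nat \<Rightarrow> nat" where s: "strict_mono s" "\<And>k. \<bar>f (s k)\<bar> \<ge> e"
    using infinite_enumerate[OF inf] by auto
  obtain r where "(\<lambda>k. f (s (r k))) \<longlonglongrightarrow> 0"
    using assms[OF s(1)] by blast
  then have "(\<lambda>k. \<bar>f (s (r k))\<bar>) \<longlonglongrightarrow> 0"
    by (rule tendsto_rabs_zero)
  then have "e \<le> 0"
    by (rule LIMSEQ_le_const) (use s(2) in auto)
  with e(1) show False by simp
qed

section \<open>Moments of a rotation-invariant measure\<close>

definition total_degree :: "('n::finite \<Rightarrow> nat) \<Rightarrow> nat" where
  "total_degree \<alpha> = (\<Sum>i\<in>UNIV. \<alpha> i)"

abbreviation increment :: "('n \<Rightarrow> nat) \<Rightarrow> 'n \<Rightarrow> 'n \<Rightarrow> nat" where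
  "increment \<alpha> j \<equiv> \<alpha>(j := Suc (\<alpha> j))"

lemma monomial_update:
  "monomial (\<alpha>(j := m)) z = z $ j ^ m * (\<Prod>i\<in>UNIV - {j}. z $ i ^ \<alpha> i)"
proof -
  have "monomial (\<alpha>(j := m)) z = z $ j ^ m * (\<Prod>i\<in>UNIV - {j}. z $ i ^ (\<alpha>(j := m)) i)"
    unfolding monomial_def by (subst prod.remove[of _ j]) auto
  also have "(\<Prod>i\<in>UNIV - {j}. z $ i ^ (\<alpha>(j := m)) i) = (\<Prod>i\<in>UNIV - {j}. z $ i ^ \<alpha> i)"
    by (intro prod.cong) auto
  finally show ?thesis .
qed

lemma monomial_increment: "monomial (increment \<alpha> j) z = z $ j * monomial \<alpha> z"
proof -
  have "monomial \<alpha> z = z $ j ^ \<alpha> j * (\<Prod>i\<in>UNIV - {j}. z $ i ^ \<alpha> i)"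
    using monomial_update[of \<alpha> j "\<alpha> j" z] by simp
  then show ?thesis by (simp add: monomial_update)
qed

lemma total_degree_update: "total_degree (\<alpha>(j := m)) + \<alpha> j = total_degree \<alpha> + m"
proof -
  have "total_degree (\<alpha>(j := m)) = m + (\<Sum>i\<in>UNIV - {j}. (\<alpha>(j := m)) i)"
    unfolding total_degree_def by (subst sum.remove[of _ j]) auto
  also have "(\<Sum>i\<in>UNIV - {j}. (\<alpha>(j := m)) i) = (\<Sum>i\<in>UNIV - {j}. \<alpha> i)"
    by (intro sum.cong) auto
  moreover have "total_degree \<alpha> = \<alpha> j + (\<Sum>i\<in>UNIV - {j}. \<alpha> i)"
    unfolding total_degree_def by (subst sum.remove[of _ j]) auto
  ultimately show ?thesis by simp
qed

lemma total_degree_increment: "total_degree (increment \<alpha> j) = Suc (total_degree \<alpha>)"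
  using total_degree_update[of \<alpha> j "Suc (\<alpha> j)"] by simp

lemma norm_monomial_le: "cmod (monomial \<alpha> z) \<le> norm z ^ total_degree \<alpha>"
proof -
  have "cmod (monomial \<alpha> z) = (\<Prod>i\<in>UNIV. cmod (z $ i) ^ \<alpha> i)"
    by (simp add: monomial_def norm_power flip: prod_norm)
  also have "\<dots> \<le> (\<Prod>i\<in>UNIV. norm z ^ \<alpha> i)"
    by (intro prod_mono conjI power_mono Finite_Cartesian_Product.norm_nth_le) auto
  also have "\<dots> = norm z ^ total_degree \<alpha>"
    by (simp add: total_degree_def power_sum)
  finally show ?thesis .
qed

lemma borel_measurable_monomial: "monomial \<alpha> \<in> borel_measurable borel"
  unfolding monomial_def[abs_def]
  by (intro borel_measurable_continuous_onI continuous_intros)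

lemma norm_power2_vec: "(norm (z :: complex^'n))\<^sup>2 = (\<Sum>i\<in>UNIV. (cmod (z $ i))\<^sup>2)"
  by (simp add: norm_vec_def L2_set_def sum_nonneg)

definition diagonal_matrix :: "('n \<Rightarrow> complex) \<Rightarrow> complex^'n^'n" where
  "diagonal_matrix u = (\<chi> i l. if l = i then u i else 0)"

lemma diagonal_matrix_mult_vec: "(diagonal_matrix u *v z) $ i = u i * z $ i"
  by (simp add: diagonal_matrix_def matrix_vector_mult_def if_distrib[of "\<lambda>x. x * _"] cong: if_cong)

lemma unitary_diagonal_matrix:
  assumes "\<And>i. cmod (u i) = 1"
  shows "unitary_matrix (diagonal_matrix u)"
proof -
  have "(\<chi> i l. cnj (diagonal_matrix u $ l $ i)) = diagonal_matrix (\<lambda>i. cnj (u i))"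
    by (auto simp: diagonal_matrix_def vec_eq_iff)
  moreover have "u i * cnj (u i) = 1" for i
    using assms[of i] complex_norm_square[of "u i"] by simp
  ultimately show ?thesis
    by (auto simp: unitary_matrix_def matrix_eq vec_eq_iff diagonal_matrix_mult_vec mult.commute
        simp flip: matrix_vector_mul_assoc mult.assoc)
qed

definition plane_rotation :: "'n \<Rightarrow> 'n \<Rightarrow> real \<Rightarrow> real \<Rightarrow> complex^'n^'n" where
  "plane_rotation j k c s = (\<chi> i l.
     if i = j then (if l = j then of_real c else if l = k then of_real s else 0)
     else if i = k then (if l = j then - of_real s else if l = k then of_real c else 0)
     else if l = i then 1 else 0)"

lemma plane_rotation_mult_vec:
  assumes "j \<noteq> k"
  shows "(plane_rotation j k c s *v z) $ i =
    (if i = j then of_real c * z $ j + of_real s * z $ k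
     else if i = k then of_real c * z $ k - of_real s * z $ j else z $ i)"
proof -
  have split: "(\<Sum>l\<in>UNIV. if l = j then a else if l = k then b else 0) = a + b" for a b :: complex
  proof -
    have "(\<Sum>l\<in>UNIV. if l = j then a else if l = k then b else 0) =
        (\<Sum>l\<in>UNIV. (if l = j then a else 0) + (if l = k then b else 0))"
      using assms by (intro sum.cong) auto
    then show ?thesis by (simp add: sum.distrib)
  qed
  have "(plane_rotation j k c s *v z) $ i = (\<Sum>l\<in>UNIV.
     if i = j then (if l = j then of_real c * z $ j else if l = k then of_real s * z $ k else 0)
     else if i = k then (if l = j then - of_real s * z $ j else if l = k then of_real c * z $ k else 0)
     else if l = i then z $ i else 0)"
    unfolding plane_rotation_def matrix_vector_mult_def vec_lambda_beta
    by (intro sum.cong refl) auto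
  then show ?thesis
    using assms by (auto simp: split)
qed

lemma unitary_plane_rotation:
  assumes "j \<noteq> k" "c\<^sup>2 + s\<^sup>2 = 1"
  shows "unitary_matrix (plane_rotation j k c s)"
proof -
  have adj: "(\<chi> i l. cnj (plane_rotation j k c s $ l $ i)) = plane_rotation j k c (- s)"
    using assms(1) by (auto simp: plane_rotation_def vec_eq_iff)
  have inv: "plane_rotation j k c t *v (plane_rotation j k c (- t) *v z) = z"
    if "c\<^sup>2 + t\<^sup>2 = 1" for t z
  proof -
    have *: "of_real c * (of_real c * a) + of_real t * (of_real t * a) = a" for a :: complex
      using that by (simp add: power2_eq_square flip: mult.assoc distrib_right of_real_mult of_real_add)
    show ?thesis
      using assms(1) by (simp add: vec_eq_iff plane_rotation_mult_vec algebra_simps *)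
  qed
  show ?thesis
    using inv[of s] inv[of "- s"] assms(2)
    by (auto simp: unitary_matrix_def adj matrix_eq simp flip: matrix_vector_mul_assoc)
qed

lemma norm_plane_rotation:
  assumes "j \<noteq> k" "c\<^sup>2 + s\<^sup>2 = 1"
  shows "norm (plane_rotation j k c s *v z) = norm z"
proof -
  let ?w = "plane_rotation j k c s *v z"
  have split: "(\<Sum>i\<in>UNIV. f i) = f j + f k + (\<Sum>i\<in>UNIV - {j} - {k}. f i)" for f :: "_ \<Rightarrow> real"
    using assms(1) by (subst sum.remove[of _ j], simp, simp, subst sum.remove[of _ k]) auto
  have "(cmod (of_real c * a + of_real s * b))\<^sup>2 + (cmod (of_real c * b - of_real s * a))\<^sup>2 =
      (c\<^sup>2 + s\<^sup>2) * ((cmod a)\<^sup>2 + (cmod b)\<^sup>2)" for a b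
    unfolding cmod_power2 by (simp add: power2_eq_square algebra_simps)
  then have "(norm ?w)\<^sup>2 = (norm z)\<^sup>2"
    unfolding norm_power2_vec split using assms by (simp add: plane_rotation_mult_vec)
  then show ?thesis by simp
qed

locale rotation_invariant_measure =
  fixes \<mu> :: "(complex^'n) measure"
  assumes sets_eq: "sets \<mu> = sets borel"
    and rotation_invariant: "rotation_invariant \<mu>"
    and integrable_moment: "\<And>d. integrable \<mu> (\<lambda>z. norm z ^ (2 * d))"
    and moment_pos: "\<And>d. 0 < moment \<mu> d"
begin

lemma borel_measurable_eq: "borel_measurable \<mu> = borel_measurable borel"
  by (rule measurable_cong_sets[OF sets_eq refl])

lemma integral_unitary:
  fixes f :: "complex^'n \<Rightarrow> complex"
  assumes U: "unitary_matrix U" and f: "f \<in> borel_measurable \<mu>"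
  shows "(LINT z|\<mu>. f (U *v z)) = (LINT z|\<mu>. f z)"
proof -
  have "(\<lambda>z. U *v z) \<in> borel_measurable borel"
    unfolding matrix_vector_mult_def
    by (intro borel_measurable_continuous_onI continuous_intros)
  then have "(\<lambda>z. U *v z) \<in> measurable \<mu> \<mu>"
    by (simp add: measurable_cong_sets[OF sets_eq sets_eq])
  from integral_distr[OF this f] show ?thesis
    using rotation_invariant U by (simp add: rotation_invariant_def)
qed

lemma integrable_norm_power: "integrable \<mu> (\<lambda>z. norm z ^ m)"
proof (rule Bochner_Integration.integrable_bound)
  show "integrable \<mu> (\<lambda>z. norm z ^ (2 * 0) + norm z ^ (2 * m))"
    by (intro Bochner_Integration.integrable_add integrable_moment)
  show "(\<lambda>z. norm z ^ m) \<in> borel_measurable \<mu>"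
    unfolding borel_measurable_eq by measurable
  have "x ^ m \<le> 1 + x ^ (2 * m)" if "x \<ge> 0" for x :: real
    using sum_squares_bound[of 1 "x ^ m"] zero_le_power[OF that, of m]
    by (simp add: power_mult mult.commute[of 2] flip: power2_eq_square) 
  then show "AE z in \<mu>. norm (norm z ^ m) \<le> norm (norm z ^ (2 * 0) + norm z ^ (2 * m))"
    by simp
qed

lemma finite_measure: "finite_measure \<mu>"
proof
  have "(\<integral>\<^sup>+z. ennreal (norm ((norm z :: real) ^ (2 * 0))) \<partial>\<mu>) < \<infinity>"
    using integrable_moment[of 0] unfolding integrable_iff_bounded by blast
  then show "emeasure \<mu> (space \<mu>) \<noteq> \<infinity>"
    by simp
qed

lemma integrable_weighted_monomials:
  "integrable \<mu> (\<lambda>z. of_real (norm z ^ m) * (monomial \<alpha> z * cnj (monomial \<beta> z)))"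
proof (rule Bochner_Integration.integrable_bound)
  show "integrable \<mu> (\<lambda>z. norm z ^ (m + total_degree \<alpha> + total_degree \<beta>))"
    by (rule integrable_norm_power)
  note [measurable] = borel_measurable_monomial
  show "(\<lambda>z. of_real (norm z ^ m) * (monomial \<alpha> z * cnj (monomial \<beta> z))) \<in> borel_measurable \<mu>"
    unfolding borel_measurable_eq by measurable
  have "norm (of_real (norm z ^ m) * (monomial \<alpha> z * cnj (monomial \<beta> z)))
      \<le> norm z ^ m * (norm z ^ total_degree \<alpha> * norm z ^ total_degree \<beta>)" for z :: "complex^'n"
    by (simp add: norm_mult norm_power mult_left_mono mult_mono norm_monomial_le)
  then show "AE z in \<mu>. norm (of_real (norm z ^ m) * (monomial \<alpha> z * cnj (monomial \<beta> z)))
      \<le> norm (norm z ^ (m + total_degree \<alpha> + total_degree \<beta>))"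
    by (simp add: power_add mult.assoc)
qed

text \<open>The weight \<open>|z|\<^sup>2\<^sup>m\<close> is unchanged by unitary maps, so it costs nothing in the symmetry
  arguments. It is what closes the induction on the degree below: \<open>|z|\<^sup>2 = \<Sum>\<^sub>l |z\<^sub>l|\<^sup>2\<close> trades one
  power of the weight for one degree of the monomial.\<close>

definition weighted_inner :: "nat \<Rightarrow> ('n \<Rightarrow> nat) \<Rightarrow> ('n \<Rightarrow> nat) \<Rightarrow> complex" where
  "weighted_inner m \<alpha> \<beta> =
     (LINT z|\<mu>. of_real (norm z ^ (2 * m)) * (monomial \<alpha> z * cnj (monomial \<beta> z)))"

text \<open>Multiplying one coordinate by a suitable unit scalar changes the sign of the integrand.\<close>

lemma weighted_inner_orthogonal:
  assumes "\<alpha> \<noteq> \<beta>"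
  shows "weighted_inner m \<alpha> \<beta> = 0"
proof -
  from assms obtain l where l: "\<alpha> l \<noteq> \<beta> l" by auto
  \<comment> \<open>with this angle the integrand is multiplied by \<open>cis \<pi> = -1\<close>\<close>
  define \<theta> where "\<theta> = pi / (real (\<alpha> l) - real (\<beta> l))"
  define u where "u i = (if i = l then cis \<theta> else 1)" for i
  have u: "unitary_matrix (diagonal_matrix u)"
    by (rule unitary_diagonal_matrix) (simp add: u_def)
  have mon: "monomial \<gamma> (diagonal_matrix u *v z) = cis \<theta> ^ \<gamma> l * monomial \<gamma> z" for \<gamma> and z :: "complex^'n"
  proof -
    have "(\<Prod>i\<in>UNIV. u i ^ \<gamma> i) = cis \<theta> ^ \<gamma> l"
      by (subst prod.remove[of _ l]) (auto simp: u_def)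
    then show ?thesis
      by (simp add: monomial_def diagonal_matrix_mult_vec power_mult_distrib prod.distrib)
  qed
  have nrm: "norm (diagonal_matrix u *v z) = norm z" for z :: "complex^'n"
  proof -
    have "cmod (u i * z $ i) = cmod (z $ i)" for i
      by (simp add: u_def norm_mult)
    then show ?thesis
      by (simp add: norm_vec_def diagonal_matrix_mult_vec)
  qed
  have "(real (\<alpha> l) - real (\<beta> l)) * \<theta> = pi"
    using l by (simp add: \<theta>_def)
  then have "real (\<alpha> l) * \<theta> - real (\<beta> l) * \<theta> = pi"
    by (simp only: left_diff_distrib)
  moreover have "cnj (cis t) = cis (- t)" for t
    by (simp add: complex_eq_iff)
  ultimately have sign: "cis \<theta> ^ \<alpha> l * cnj (cis \<theta> ^ \<beta> l) = -1"
    by (simp only: Complex.DeMoivre cis_mult add_uminus_conv_diff cis_pi)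
  note [measurable] = borel_measurable_monomial
  have "weighted_inner m \<alpha> \<beta> = (LINT z|\<mu>. of_real (norm (diagonal_matrix u *v z) ^ (2 * m)) *
      (monomial \<alpha> (diagonal_matrix u *v z) * cnj (monomial \<beta> (diagonal_matrix u *v z))))"
    unfolding weighted_inner_def
    by (rule integral_unitary[OF u, symmetric]) (unfold borel_measurable_eq, measurable)
  also have "\<dots> = (LINT z|\<mu>. (cis \<theta> ^ \<alpha> l * cnj (cis \<theta> ^ \<beta> l)) *
      (of_real (norm z ^ (2 * m)) * (monomial \<alpha> z * cnj (monomial \<beta> z))))"
    unfolding mon nrm by (intro Bochner_Integration.integral_cong) (auto simp: mult_ac)
  also have "\<dots> = - weighted_inner m \<alpha> \<beta>"
    unfolding sign weighted_inner_def by simp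
  finally show ?thesis by simp
qed

text \<open>Rotating the plane of the coordinates \<open>j\<close> and \<open>k\<close> so that \<open>z\<^sub>j\<close> becomes a multiple of
  \<open>z\<^sub>j + s z\<^sub>k\<close>, and expanding \<open>(z\<^sub>j + s z\<^sub>k)\<^sup>N\<close> into orthogonal monomials, expresses
  \<open>(1 + s\<^sup>2)\<^sup>N\<close> times one moment as a polynomial in \<open>s\<^sup>2\<close> with the other moments as
  coefficients. The binomial theorem for \<open>(1 + s\<^sup>2)\<^sup>N\<close> then gives each of them.\<close>

lemma weighted_inner_plane:
  fixes m :: nat
  assumes jk: "j \<noteq> k" and \<rho>: "\<rho> j = 0" "\<rho> k = 0" and i: "i \<le> N"
  defines "W \<equiv> \<lambda>i. weighted_inner m (\<rho>(j := N - i, k := i)) (\<rho>(j := N - i, k := i))"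
  shows "of_nat (N choose i) * W i = W 0"
proof -
  have expand: "(\<Sum>i\<le>N. (of_nat (N choose i))\<^sup>2 * W i * of_real (s\<^sup>2) ^ i) =
      (\<Sum>i\<le>N. of_nat (N choose i) * W 0 * of_real (s\<^sup>2) ^ i)" for s :: real
  proof -
    define r where "r = sqrt (1 + s\<^sup>2)"
    have r: "r > 0" "r\<^sup>2 = 1 + s\<^sup>2"
      by (auto simp: r_def add_pos_nonneg)
    define R where "R = plane_rotation j k (1 / r) (s / r)"
    have "1 + s\<^sup>2 \<noteq> 0"
      using r by auto
    then have cs: "(1 / r)\<^sup>2 + (s / r)\<^sup>2 = 1"
      using r by (simp add: power_divide flip: add_divide_distrib)
    define e where "e i = \<rho>(j := N - i, k := i)" for i
    have mon: "of_real r ^ N * monomial (e 0) (R *v z) =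
        (\<Sum>i\<le>N. (of_nat (N choose i) * of_real s ^ i) * monomial (e i) z)" for z :: "complex^'n"
    proof -
      let ?P = "\<Prod>l\<in>UNIV - {j} - {k}. z $ l ^ \<rho> l"
      have split: "monomial \<gamma> w = w $ j ^ \<gamma> j * (w $ k ^ \<gamma> k * (\<Prod>l\<in>UNIV - {j} - {k}. w $ l ^ \<gamma> l))"
        for \<gamma> and w :: "complex^'n"
        using jk unfolding monomial_def
        by (subst prod.remove[of _ j], simp, simp, subst prod.remove[of _ k]) auto
      have P: "(\<Prod>l\<in>UNIV - {j} - {k}. w $ l ^ e i l) = ?P"
        if "\<And>l. l \<noteq> j \<Longrightarrow> l \<noteq> k \<Longrightarrow> w $ l = z $ l" for i and w :: "complex^'n"
        using that by (intro prod.cong) (auto simp: e_def)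
      have Rj: "of_real r * (R *v z) $ j = of_real s * z $ k + z $ j"
        using r jk by (simp add: R_def plane_rotation_mult_vec field_simps)
      have "of_real r ^ N * monomial (e 0) (R *v z) = (of_real r * (R *v z) $ j) ^ N * ?P"
        using jk by (subst split, subst P)
          (auto simp: R_def plane_rotation_mult_vec e_def power_mult_distrib mult_ac)
      also have "\<dots> = (\<Sum>i\<le>N. of_nat (N choose i) * (of_real s * z $ k) ^ i * (z $ j) ^ (N - i)) * ?P"
        unfolding Rj binomial_ring ..
      also have "\<dots> = (\<Sum>i\<le>N. (of_nat (N choose i) * of_real s ^ i) * monomial (e i) z)"
        unfolding sum_distrib_right split P[OF refl] using jk
        by (intro sum.cong) (auto simp: e_def power_mult_distrib)
      finally show ?thesis .
    qed
    note [measurable] = borel_measurable_monomial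
    have "(\<lambda>z. of_real (norm z ^ (2 * m)) * (monomial (e 0) z * cnj (monomial (e 0) z))) \<in> borel_measurable \<mu>"
      unfolding borel_measurable_eq by measurable
    from integral_unitary[OF unitary_plane_rotation[OF jk cs] this]
    have "(of_real r ^ N * cnj (of_real r ^ N)) * W 0 = (of_real r ^ N * cnj (of_real r ^ N)) *
        (LINT z|\<mu>. of_real (norm (R *v z) ^ (2 * m)) * (monomial (e 0) (R *v z) * cnj (monomial (e 0) (R *v z))))"
      by (simp only: W_def weighted_inner_def e_def[symmetric] R_def)
    also have "\<dots> = (LINT z|\<mu>. (of_real r ^ N * cnj (of_real r ^ N)) *
        (of_real (norm (R *v z) ^ (2 * m)) * (monomial (e 0) (R *v z) * cnj (monomial (e 0) (R *v z)))))"
      by (rule integral_mult_right_zero[symmetric])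
    also have "\<dots> = (LINT z|\<mu>. of_real (norm z ^ (2 * m)) *
        ((of_real r ^ N * monomial (e 0) (R *v z)) * cnj (of_real r ^ N * monomial (e 0) (R *v z))))"
      unfolding R_def norm_plane_rotation[OF jk cs]
      by (intro Bochner_Integration.integral_cong) (auto simp: mult_ac)
    also have "\<dots> = (LINT z|\<mu>. (\<Sum>i\<le>N. \<Sum>i'\<le>N. (of_nat (N choose i) * of_real s ^ i) *
        (of_nat (N choose i') * of_real s ^ i') *
        (of_real (norm z ^ (2 * m)) * (monomial (e i) z * cnj (monomial (e i') z)))))"
    proof (intro Bochner_Integration.integral_cong refl)
      fix z :: "complex^'n"
      let ?a = "\<lambda>i. (of_nat (N choose i) * of_real s ^ i) * monomial (e i) z"
      have "of_real (norm z ^ (2 * m)) * ((\<Sum>i\<le>N. ?a i) * cnj (\<Sum>i\<le>N. ?a i)) =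
          (\<Sum>i\<le>N. \<Sum>i'\<le>N. of_real (norm z ^ (2 * m)) * (?a i * cnj (?a i')))"
        by (simp only: cnj_sum sum_product) (simp only: sum_distrib_left)
      also have "\<dots> = (\<Sum>i\<le>N. \<Sum>i'\<le>N. (of_nat (N choose i) * of_real s ^ i) *
        (of_nat (N choose i') * of_real s ^ i') *
        (of_real (norm z ^ (2 * m)) * (monomial (e i) z * cnj (monomial (e i') z))))"
        by (intro sum.cong refl) (simp add: mult_ac)
      finally show "of_real (norm z ^ (2 * m)) *
          ((of_real r ^ N * monomial (e 0) (R *v z)) * cnj (of_real r ^ N * monomial (e 0) (R *v z))) =
        (\<Sum>i\<le>N. \<Sum>i'\<le>N. (of_nat (N choose i) * of_real s ^ i) *
        (of_nat (N choose i') * of_real s ^ i') *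
        (of_real (norm z ^ (2 * m)) * (monomial (e i) z * cnj (monomial (e i') z))))"
        unfolding mon .
    qed
    also have "\<dots> = (\<Sum>i\<le>N. LINT z|\<mu>. (\<Sum>i'\<le>N. (of_nat (N choose i) * of_real s ^ i) *
        (of_nat (N choose i') * of_real s ^ i') *
        (of_real (norm z ^ (2 * m)) * (monomial (e i) z * cnj (monomial (e i') z)))))"
      by (intro Bochner_Integration.integral_sum Bochner_Integration.integrable_sum
          integrable_mult_right integrable_weighted_monomials)
    also have "\<dots> = (\<Sum>i\<le>N. \<Sum>i'\<le>N. LINT z|\<mu>. (of_nat (N choose i) * of_real s ^ i) *
        (of_nat (N choose i') * of_real s ^ i') *
        (of_real (norm z ^ (2 * m)) * (monomial (e i) z * cnj (monomial (e i') z))))"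
      by (intro sum.cong refl Bochner_Integration.integral_sum
          integrable_mult_right integrable_weighted_monomials)
    also have "\<dots> = (\<Sum>i\<le>N. \<Sum>i'\<le>N. (of_nat (N choose i) * of_real s ^ i) *
        (of_nat (N choose i') * of_real s ^ i') * weighted_inner m (e i) (e i'))"
      unfolding weighted_inner_def by (intro sum.cong refl integral_mult_right_zero)
    also have "\<dots> = (\<Sum>i\<le>N. \<Sum>i'\<le>N. if i' = i then (of_nat (N choose i) * of_real s ^ i) *
        (of_nat (N choose i) * of_real s ^ i) * W i else 0)"
    proof (intro sum.cong refl)
      fix i i' :: nat
      have "e i \<noteq> e i'" if "i' \<noteq> i"
        using that by (auto simp: e_def dest!: fun_cong[where x = k])
      then show "(of_nat (N choose i) * of_real s ^ i) * (of_nat (N choose i') * of_real s ^ i') *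
          weighted_inner m (e i) (e i') = (if i' = i then (of_nat (N choose i) * of_real s ^ i) *
          (of_nat (N choose i) * of_real s ^ i) * W i else 0)"
        by (auto simp: W_def e_def[symmetric] weighted_inner_orthogonal)
    qed
    also have "\<dots> = (\<Sum>i\<le>N. (of_nat (N choose i))\<^sup>2 * W i * of_real (s\<^sup>2) ^ i)"
      by (intro sum.cong) (auto simp: power2_eq_square power_mult_distrib)
    finally have lhs: "(of_real r ^ N * cnj (of_real r ^ N)) * W 0 =
      (\<Sum>i\<le>N. (of_nat (N choose i))\<^sup>2 * W i * of_real (s\<^sup>2) ^ i)" .
    have "of_real r ^ N * cnj (of_real r ^ N) = (of_real (r\<^sup>2)) ^ N"
      by (simp add: power2_eq_square power_mult_distrib)
    also have "\<dots> = (of_real (s\<^sup>2) + 1) ^ N"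
      unfolding r(2) by (simp add: add.commute)
    also have "\<dots> = (\<Sum>i\<le>N. of_nat (N choose i) * of_real (s\<^sup>2) ^ i)"
      unfolding binomial_ring by simp
    finally have "(\<Sum>i\<le>N. (of_nat (N choose i))\<^sup>2 * W i * of_real (s\<^sup>2) ^ i) =
        (\<Sum>i\<le>N. of_nat (N choose i) * of_real (s\<^sup>2) ^ i) * W 0"
      by (simp only: lhs[symmetric])
    then show ?thesis
      unfolding sum_distrib_right by (simp only: mult_ac)
  qed
  \<comment> \<open>the two polynomials in \<open>s\<^sup>2\<close> agree on \<open>{0..}\<close>, hence coefficientwise\<close>
  define a where "a i = (of_nat (N choose i))\<^sup>2 * W i - of_nat (N choose i) * W 0" for i
  have "a i = 0"
  proof (rule ccontr)
    assume "a i \<noteq> 0"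
    then have "finite {x. (\<Sum>i\<le>N. a i * x ^ i) = 0}"
      using polyfun_finite_roots[where c = a and n = N] i by blast
    moreover have "of_real ` {0..} \<subseteq> {x. (\<Sum>i\<le>N. a i * x ^ i) = 0}"
    proof (intro image_subsetI CollectI)
      fix x :: real assume "x \<in> {0..}"
      then show "(\<Sum>i\<le>N. a i * of_real x ^ i) = 0"
        using expand[of "sqrt x"] by (simp add: a_def left_diff_distrib sum_subtractf)
    qed
    ultimately have "finite (of_real ` {0::real..} :: complex set)"
      by (rule finite_subset[rotated])
    then have "finite {0::real..}"
      by (rule finite_imageD) (simp add: inj_on_def)
    then show False
      using infinite_Ici by blast
  qed
  then have "of_nat (N choose i) * (of_nat (N choose i) * W i - W 0) = 0"
    by (simp add: a_def power2_eq_square algebra_simps)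
  moreover have "(of_nat (N choose i) :: complex) \<noteq> 0"
    using i by (simp add: binomial_eq_0_iff)
  ultimately show ?thesis by simp
qed

text \<open>Both moments are compared, via the binomial coefficients of \<open>N = \<gamma>\<^sub>j + \<gamma>\<^sub>k + 1\<close>, with the one in
  which \<open>z\<^sub>j\<close> carries the whole exponent \<open>N\<close>.\<close>

lemma weighted_inner_increment:
  "of_nat (Suc (\<gamma> k)) * weighted_inner m (increment \<gamma> j) (increment \<gamma> j) =
   of_nat (Suc (\<gamma> j)) * weighted_inner m (increment \<gamma> k) (increment \<gamma> k)"
proof (cases "j = k")
  case False
  define \<rho> where "\<rho> = \<gamma>(j := 0, k := 0)"
  define N where "N = \<gamma> j + \<gamma> k + 1"
  define W where "W i = weighted_inner m (\<rho>(j := N - i, k := i)) (\<rho>(j := N - i, k := i))" for i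
  have W: "of_nat (N choose i) * W i = W 0" if "i \<le> N" for i
    unfolding W_def using False that by (intro weighted_inner_plane) (auto simp: \<rho>_def)
  have inc: "increment \<gamma> j = \<rho>(j := N - \<gamma> k, k := \<gamma> k)"
      "increment \<gamma> k = \<rho>(j := N - Suc (\<gamma> k), k := Suc (\<gamma> k))"
    using False by (auto simp: \<rho>_def N_def)
  have bin: "Suc (\<gamma> k) * (N choose Suc (\<gamma> k)) = Suc (\<gamma> j) * (N choose \<gamma> k)"
    using binomial_absorb_comp[of N "\<gamma> k"] binomial_absorption[of "\<gamma> k" N]
    by (simp add: N_def Suc_diff_le)
  have eq: "of_nat (N choose \<gamma> k) * W (\<gamma> k) = of_nat (N choose Suc (\<gamma> k)) * W (Suc (\<gamma> k))"
    by (subst (1 2) W) (simp_all add: N_def)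
  have "of_nat (N choose \<gamma> k) * (of_nat (Suc (\<gamma> k)) * W (\<gamma> k)) =
      of_nat (Suc (\<gamma> k)) * (of_nat (N choose \<gamma> k) * W (\<gamma> k))"
    by (simp only: mult_ac)
  also have "\<dots> = of_nat (Suc (\<gamma> k) * (N choose Suc (\<gamma> k))) * W (Suc (\<gamma> k))"
    unfolding eq by (simp only: of_nat_mult mult_ac)
  also have "\<dots> = of_nat (N choose \<gamma> k) * (of_nat (Suc (\<gamma> j)) * W (Suc (\<gamma> k)))"
    unfolding bin by (simp only: of_nat_mult mult_ac)
  finally show ?thesis
    unfolding inc W_def[symmetric] by (simp add: N_def binomial_eq_0_iff del: of_nat_Suc)
qed simp

lemma sum_weighted_inner_increment:
  "(\<Sum>l\<in>UNIV. weighted_inner m (increment \<gamma> l) (increment \<gamma> l)) = weighted_inner (Suc m) \<gamma> \<gamma>"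
proof -
  have "(\<Sum>l\<in>UNIV. weighted_inner m (increment \<gamma> l) (increment \<gamma> l)) =
      (LINT z|\<mu>. (\<Sum>l\<in>UNIV. of_real (norm z ^ (2 * m)) *
        (monomial (increment \<gamma> l) z * cnj (monomial (increment \<gamma> l) z))))"
    unfolding weighted_inner_def
    by (rule Bochner_Integration.integral_sum[symmetric]) (rule integrable_weighted_monomials)
  also have "\<dots> = weighted_inner (Suc m) \<gamma> \<gamma>"
    unfolding weighted_inner_def
  proof (intro Bochner_Integration.integral_cong refl)
    fix z :: "complex^'n"
    have "(\<Sum>l\<in>UNIV. of_real (norm z ^ (2 * m)) *
          (monomial (increment \<gamma> l) z * cnj (monomial (increment \<gamma> l) z))) =
        (\<Sum>l\<in>UNIV. of_real ((cmod (z $ l))\<^sup>2)) * (of_real (norm z ^ (2 * m)) * (monomial \<gamma> z * cnj (monomial \<gamma> z)))"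
      unfolding sum_distrib_right monomial_increment complex_norm_square
      by (intro sum.cong) (auto simp: mult_ac)
    also have "(\<Sum>l\<in>UNIV. of_real ((cmod (z $ l))\<^sup>2)) = (of_real ((norm z)\<^sup>2) :: complex)"
      by (simp only: norm_power2_vec of_real_sum)
    also have "of_real ((norm z)\<^sup>2) * (of_real (norm z ^ (2 * m)) * (monomial \<gamma> z * cnj (monomial \<gamma> z))) =
        of_real (norm z ^ (2 * Suc m)) * (monomial \<gamma> z * cnj (monomial \<gamma> z))"
      by (simp add: power2_eq_square mult_ac)
    finally show "(\<Sum>l\<in>UNIV. of_real (norm z ^ (2 * m)) *
          (monomial (increment \<gamma> l) z * cnj (monomial (increment \<gamma> l) z))) =
        of_real (norm z ^ (2 * Suc m)) * (monomial \<gamma> z * cnj (monomial \<gamma> z))" .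
  qed
  finally show ?thesis .
qed

text \<open>The moments of \<open>z\<^sup>\<gamma> z\<^sub>l\<close> are proportional to \<open>\<gamma>\<^sub>l + 1\<close> and add up to the moment of \<open>z\<^sup>\<gamma>\<close> with
  one more power of \<open>|z|\<^sup>2\<close>; as \<open>\<Sum>\<^sub>l (\<gamma>\<^sub>l + 1) = n + |\<gamma>|\<close>, each of them is determined.\<close>

lemma weighted_inner_self:
  "weighted_inner m \<alpha> \<alpha> = of_real ((\<Prod>i\<in>UNIV. fact (\<alpha> i)) * moment \<mu> (m + total_degree \<alpha>) /
     pochhammer (real CARD('n)) (total_degree \<alpha>))"
proof (induction "total_degree \<alpha>" arbitrary: \<alpha> m)
  case 0
  then have "\<alpha> = (\<lambda>i. 0)"
    by (auto simp: total_degree_def)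
  then show ?case
    by (simp add: weighted_inner_def monomial_def moment_def total_degree_def flip: integral_complex_of_real)
next
  case (Suc d)
  then have "\<exists>j. \<alpha> j \<noteq> 0"
    unfolding total_degree_def by (metis nat.distinct(1) sum.neutral)
  then obtain j where j: "\<alpha> j \<noteq> 0" by blast
  define \<gamma> where "\<gamma> = \<alpha>(j := \<alpha> j - 1)"
  have \<alpha>: "\<alpha> = increment \<gamma> j"
    using j by (auto simp: \<gamma>_def)
  have d: "total_degree \<gamma> = d"
    using Suc(2) by (simp add: \<alpha> total_degree_increment)
  let ?n = "real CARD('n)" and ?F = "\<lambda>\<alpha>. \<Prod>i\<in>UNIV. fact (\<alpha> i) :: real"
  have fact: "?F \<alpha> = real (Suc (\<gamma> j)) * ?F \<gamma>"
  proof -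
    have "?F \<gamma> = fact (\<gamma> j) * (\<Prod>i\<in>UNIV - {j}. fact (\<gamma> i))"
      by (subst prod.remove[of _ j]) auto
    moreover have "?F \<alpha> = fact (Suc (\<gamma> j)) * (\<Prod>i\<in>UNIV - {j}. fact (\<gamma> i))"
      unfolding \<alpha> by (subst prod.remove[of _ j]) (auto intro!: prod.cong)
    ultimately show ?thesis by simp
  qed
  have "(\<Sum>l\<in>UNIV. real (Suc (\<gamma> l))) = ?n + real d"
    using d by (simp add: total_degree_def sum.distrib add.commute flip: of_nat_sum)
  then have "complex_of_real (\<Sum>l\<in>UNIV. real (Suc (\<gamma> l))) = of_real (?n + real d)"
    by (simp only:)
  then have "(\<Sum>l\<in>UNIV. of_nat (Suc (\<gamma> l))) = complex_of_real (?n + real d)"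
    by (simp only: of_real_sum of_real_of_nat_eq)
  then have "of_real (?n + real d) * weighted_inner m \<alpha> \<alpha> =
      (\<Sum>l\<in>UNIV. of_nat (Suc (\<gamma> l)) * weighted_inner m \<alpha> \<alpha>)"
    by (simp only: sum_distrib_right[symmetric])
  also have "\<dots> = of_nat (Suc (\<gamma> j)) * weighted_inner (Suc m) \<gamma> \<gamma>"
    unfolding \<alpha> weighted_inner_increment[of \<gamma> _ m j]
    by (simp only: sum_weighted_inner_increment flip: sum_distrib_left)
  also have "\<dots> = of_real (real (Suc (\<gamma> j)) * (?F \<gamma> * moment \<mu> (Suc m + d) / pochhammer ?n d))"
    using Suc(1)[of \<gamma> "Suc m"] d by simp
  also have "\<dots> = of_real (?n + real d) *
      of_real (?F \<alpha> * moment \<mu> (m + Suc d) / pochhammer ?n (Suc d))"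
  proof -
    have "?n + real d \<noteq> 0"
      by (simp add: add_nonneg_eq_0_iff)
    then have "real (Suc (\<gamma> j)) * (?F \<gamma> * moment \<mu> (Suc m + d) / pochhammer ?n d) =
        (?n + real d) * (?F \<alpha> * moment \<mu> (m + Suc d) / pochhammer ?n (Suc d))"
      unfolding fact pochhammer_Suc by (simp add: mult_ac)
    then show ?thesis
      by (simp only: of_real_mult[symmetric])
  qed
  finally have "of_real (?n + real d) * weighted_inner m \<alpha> \<alpha> = of_real (?n + real d) *
      of_real (?F \<alpha> * moment \<mu> (m + Suc d) / pochhammer ?n (Suc d))" .
  moreover have "complex_of_real (?n + real d) \<noteq> 0"
    by (simp add: add_nonneg_eq_0_iff del: of_real_add)
  ultimately show ?case
    using Suc(2) by (metis mult_left_cancel)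
qed

end

section \<open>Canonical solutions for monomial forms\<close>

abbreviation decrement :: "('n \<Rightarrow> nat) \<Rightarrow> 'n \<Rightarrow> 'n \<Rightarrow> nat" where
  "decrement \<alpha> j \<equiv> \<alpha>(j := \<alpha> j - 1)"

lemma increment_inject: "increment \<alpha> j = increment \<beta> j \<longleftrightarrow> \<alpha> = \<beta>"
  by (auto simp: fun_eq_iff split: if_splits)

lemma increment_decrement: "\<alpha> j \<noteq> 0 \<Longrightarrow> increment (decrement \<alpha> j) j = \<alpha>"
  by auto

lemma increment_commute: "increment (increment \<alpha> j) k = increment (increment \<alpha> k) j"
  by (auto simp: fun_eq_iff)

lemma polynomial_monomial: "(\<lambda>z. a * monomial \<alpha> z) \<in> polynomials"
  unfolding polynomials_def by (intro CollectI exI[of _ "{\<alpha>}"] exI[of _ "\<lambda>_. a"]) auto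

lemma polynomials_add:
  assumes "p \<in> polynomials" "q \<in> polynomials"
  shows "(\<lambda>z. p z + q z) \<in> polynomials"
proof -
  obtain A c where A: "finite A" "p = (\<lambda>z. \<Sum>\<alpha>\<in>A. c \<alpha> * monomial \<alpha> z)"
    using assms(1) by (auto simp: polynomials_def)
  obtain B d where B: "finite B" "q = (\<lambda>z. \<Sum>\<alpha>\<in>B. d \<alpha> * monomial \<alpha> z)"
    using assms(2) by (auto simp: polynomials_def)
  have "(\<Sum>\<alpha>\<in>A. c \<alpha> * monomial \<alpha> z) + (\<Sum>\<alpha>\<in>B. d \<alpha> * monomial \<alpha> z) =
      (\<Sum>\<alpha>\<in>A \<union> B. ((if \<alpha> \<in> A then c \<alpha> else 0) + (if \<alpha> \<in> B then d \<alpha> else 0)) * monomial \<alpha> z)" for z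
  proof -
    have "(\<Sum>\<alpha>\<in>A. c \<alpha> * monomial \<alpha> z) = (\<Sum>\<alpha>\<in>A \<union> B. (if \<alpha> \<in> A then c \<alpha> else 0) * monomial \<alpha> z)"
      using A(1) B(1) by (intro sum.mono_neutral_cong_left) auto
    moreover have "(\<Sum>\<alpha>\<in>B. d \<alpha> * monomial \<alpha> z) = (\<Sum>\<alpha>\<in>A \<union> B. (if \<alpha> \<in> B then d \<alpha> else 0) * monomial \<alpha> z)"
      using A(1) B(1) by (intro sum.mono_neutral_cong_left) auto
    ultimately show ?thesis
      by (simp add: distrib_right sum.distrib)
  qed
  then show ?thesis
    using A B unfolding polynomials_def
    by (intro CollectI exI[of _ "A \<union> B"]
        exI[of _ "\<lambda>\<alpha>. (if \<alpha> \<in> A then c \<alpha> else 0) + (if \<alpha> \<in> B then d \<alpha> else 0)"]) auto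
qed

context rotation_invariant_measure
begin

lemma card_ge_1: "1 \<le> real CARD('n)"
  using zero_less_card_finite[where 'a = 'n] by linarith

definition monomial_sqnorm :: "('n \<Rightarrow> nat) \<Rightarrow> real" where
  "monomial_sqnorm \<alpha> = (\<Prod>i\<in>UNIV. fact (\<alpha> i)) * moment \<mu> (total_degree \<alpha>) /
     pochhammer (real CARD('n)) (total_degree \<alpha>)"

text \<open>The part of the quotient \<open>\<parallel>z\<^sub>j z\<^sup>\<alpha>\<parallel>\<^sup>2 / \<parallel>z\<^sup>\<alpha>\<parallel>\<^sup>2\<close> that depends on the degree \<open>d = |\<alpha>|\<close> only; the
  other factor is \<open>\<alpha>\<^sub>j + 1\<close>.\<close>

definition moment_ratio :: "nat \<Rightarrow> real" where
  "moment_ratio d = moment \<mu> (Suc d) / ((real CARD('n) + real d) * moment \<mu> d)"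

lemma moment_ratio_pos: "0 < moment_ratio d"
proof -
  have "0 < real CARD('n) + real d"
    using card_ge_1 by linarith
  then show ?thesis
    unfolding moment_ratio_def by (intro divide_pos_pos mult_pos_pos moment_pos)
qed

lemma monomial_sqnorm_pos: "0 < monomial_sqnorm \<alpha>"
  using card_ge_1 moment_pos[of "total_degree \<alpha>"]
  by (simp add: monomial_sqnorm_def pochhammer_pos prod_pos)

lemma monomial_sqnorm_increment:
  "monomial_sqnorm (increment \<alpha> j) =
     real (Suc (\<alpha> j)) * moment_ratio (total_degree \<alpha>) * monomial_sqnorm \<alpha>"
proof -
  let ?d = "total_degree \<alpha>"
  have "(\<Prod>i\<in>UNIV. fact (increment \<alpha> j i)) = real (Suc (\<alpha> j)) * (\<Prod>i\<in>UNIV. fact (\<alpha> i))"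
  proof -
    have "(\<Prod>i\<in>UNIV. fact (\<alpha> i)) = fact (\<alpha> j) * (\<Prod>i\<in>UNIV - {j}. fact (\<alpha> i) :: real)"
      by (subst prod.remove[of _ j]) auto
    moreover have "(\<Prod>i\<in>UNIV. fact (increment \<alpha> j i)) =
        fact (Suc (\<alpha> j)) * (\<Prod>i\<in>UNIV - {j}. fact (\<alpha> i) :: real)"
      by (subst prod.remove[of _ j]) (auto intro!: prod.cong)
    ultimately show ?thesis by simp
  qed
  then show ?thesis
    using moment_pos[of ?d] card_ge_1 pochhammer_pos[of "real CARD('n)" ?d]
    by (simp add: monomial_sqnorm_def moment_ratio_def total_degree_increment pochhammer_Suc
        mult_ac del: of_nat_Suc)
qed

lemma borel_measurable_monomial_mu [measurable]: "monomial \<alpha> \<in> borel_measurable \<mu>"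
  unfolding borel_measurable_eq by (rule borel_measurable_monomial)

lemma borel_measurable_component [measurable]: "(\<lambda>z. z $ j) \<in> borel_measurable \<mu>"
  unfolding borel_measurable_eq by (intro borel_measurable_continuous_onI continuous_intros)

lemma L2_monomial: "monomial \<alpha> \<in> L2 \<mu>"
proof -
  have "integrable \<mu> (\<lambda>z. norm (of_real (norm z ^ 0) * (monomial \<alpha> z * cnj (monomial \<alpha> z))))"
    by (intro integrable_norm integrable_weighted_monomials)
  then show ?thesis
    by (simp add: L2_def norm_mult power2_eq_square)
qed

lemma L2_inner_monomial:
  "L2_inner \<mu> (monomial \<alpha>) (monomial \<beta>) = (if \<alpha> = \<beta> then of_real (monomial_sqnorm \<alpha>) else 0)"
proof -
  have "L2_inner \<mu> (monomial \<alpha>) (monomial \<beta>) = weighted_inner 0 \<alpha> \<beta>"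
    by (simp add: L2_inner_def weighted_inner_def)
  then show ?thesis
    by (simp add: weighted_inner_orthogonal weighted_inner_self monomial_sqnorm_def)
qed

lemma L2_norm_monomial_power2: "(L2_norm \<mu> (monomial \<alpha>))\<^sup>2 = monomial_sqnorm \<alpha>"
  using L2_inner_self[of \<mu> "monomial \<alpha>"] by (simp add: L2_inner_monomial del: of_real_power)

lemma L2_cnj_monomial: "(\<lambda>z. cnj (z $ j) * monomial \<alpha> z) \<in> L2 \<mu>"
  using L2_integrable_square[OF L2_monomial[of "increment \<alpha> j"]]
  by (simp add: L2_def monomial_increment norm_mult)

lemma L2_inner_cnj_monomial_left:
  "L2_inner \<mu> (\<lambda>z. cnj (z $ j) * monomial \<alpha> z) f = L2_inner \<mu> (monomial \<alpha>) (\<lambda>z. z $ j * f z)"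
  by (simp add: L2_inner_def mult_ac)

lemma L2_inner_cnj_monomial_right:
  "L2_inner \<mu> f (\<lambda>z. cnj (z $ j) * monomial \<alpha> z) = L2_inner \<mu> (\<lambda>z. z $ j * f z) (monomial \<alpha>)"
  by (simp add: L2_inner_def mult_ac)

text \<open>The subtracted term is the orthogonal projection of \<open>z\<^sub>j\<^sup>* z\<^sup>\<alpha>\<close> to \<open>A\<^sup>2\<close>, a multiple of
  \<open>z\<^sup>\<alpha> / z\<^sub>j\<close>. If \<open>\<alpha>\<^sub>j = 0\<close> the projection is zero; the factor \<open>\<alpha>\<^sub>j\<close> makes the truncated
  differences harmless.\<close>

definition canonical_solution :: "('n \<Rightarrow> nat) \<Rightarrow> 'n \<Rightarrow> complex^'n \<Rightarrow> complex" where
  "canonical_solution \<alpha> j z = cnj (z $ j) * monomial \<alpha> z -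
     of_real (real (\<alpha> j) * moment_ratio (total_degree \<alpha> - 1)) * monomial (decrement \<alpha> j) z"

lemma L2_canonical_solution: "canonical_solution \<alpha> j \<in> L2 \<mu>"
  unfolding canonical_solution_def[abs_def]
  by (intro L2_diff L2_scale L2_cnj_monomial L2_monomial)

lemma canonical_solution_orthogonal_monomial:
  "L2_inner \<mu> (canonical_solution \<alpha> j) (monomial \<beta>) = 0"
proof -
  let ?a = "real (\<alpha> j) * moment_ratio (total_degree \<alpha> - 1)"
  have "L2_inner \<mu> (canonical_solution \<alpha> j) (monomial \<beta>) =
      L2_inner \<mu> (monomial \<alpha>) (monomial (increment \<beta> j)) -
      of_real ?a * L2_inner \<mu> (monomial (decrement \<alpha> j)) (monomial \<beta>)"
    unfolding canonical_solution_def[abs_def]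
    by (simp only: L2_inner_diff_left L2_scale L2_cnj_monomial L2_monomial
        L2_inner_scale_left L2_inner_cnj_monomial_left monomial_increment[abs_def])
  also have "\<dots> = 0"
  proof (cases "\<alpha> j = 0")
    case True
    then have "\<alpha> \<noteq> increment \<beta> j" by auto
    with True show ?thesis by (simp add: L2_inner_monomial)
  next
    case False
    define \<gamma> where "\<gamma> = decrement \<alpha> j"
    have \<alpha>: "\<alpha> = increment \<gamma> j"
      using False by (simp add: \<gamma>_def)
    have "?a = real (Suc (\<gamma> j)) * moment_ratio (total_degree \<gamma>)"
      by (simp add: \<alpha> total_degree_increment)
    then show ?thesis
      unfolding \<gamma>_def[symmetric] L2_inner_monomial \<alpha> increment_inject
      by (simp add: monomial_sqnorm_increment total_degree_increment)
  qed
  finally show ?thesis .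
qed

lemma L2_inner_canonical_solution:
  "L2_inner \<mu> (canonical_solution \<alpha> j) (canonical_solution \<beta> k) =
     L2_inner \<mu> (monomial (increment \<alpha> k)) (monomial (increment \<beta> j)) -
     of_real (real (\<alpha> j) * moment_ratio (total_degree \<alpha> - 1)) *
       L2_inner \<mu> (monomial (increment (decrement \<alpha> j) k)) (monomial \<beta>)"
proof -
  have "L2_inner \<mu> (canonical_solution \<alpha> j) (canonical_solution \<beta> k) =
      L2_inner \<mu> (canonical_solution \<alpha> j) (\<lambda>z. cnj (z $ k) * monomial \<beta> z) -
      cnj (of_real (real (\<beta> k) * moment_ratio (total_degree \<beta> - 1))) *
      L2_inner \<mu> (canonical_solution \<alpha> j) (monomial (decrement \<beta> k))"
    unfolding canonical_solution_def[of \<beta> k, abs_def]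
    by (simp only: L2_inner_diff_right L2_scale L2_cnj_monomial L2_monomial L2_canonical_solution
        L2_inner_scale_right)
  also have "\<dots> = L2_inner \<mu> (canonical_solution \<alpha> j) (\<lambda>z. cnj (z $ k) * monomial \<beta> z)"
    by (simp add: canonical_solution_orthogonal_monomial)
  also have "\<dots> = L2_inner \<mu> (\<lambda>z. cnj (z $ j) * monomial \<alpha> z) (\<lambda>z. cnj (z $ k) * monomial \<beta> z) -
      of_real (real (\<alpha> j) * moment_ratio (total_degree \<alpha> - 1)) *
      L2_inner \<mu> (monomial (decrement \<alpha> j)) (\<lambda>z. cnj (z $ k) * monomial \<beta> z)"
    unfolding canonical_solution_def[abs_def]
    by (simp only: L2_inner_diff_left L2_scale L2_cnj_monomial L2_monomial L2_inner_scale_left)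
  also have "L2_inner \<mu> (\<lambda>z. cnj (z $ j) * monomial \<alpha> z) (\<lambda>z. cnj (z $ k) * monomial \<beta> z) =
      L2_inner \<mu> (monomial (increment \<alpha> k)) (monomial (increment \<beta> j))"
    by (simp add: L2_inner_def monomial_increment mult_ac)
  also have "L2_inner \<mu> (monomial (decrement \<alpha> j)) (\<lambda>z. cnj (z $ k) * monomial \<beta> z) =
      L2_inner \<mu> (monomial (increment (decrement \<alpha> j) k)) (monomial \<beta>)"
    by (simp only: L2_inner_cnj_monomial_right monomial_increment[abs_def])
  finally show ?thesis .
qed

text \<open>The function \<open>canonical_solution \<alpha> j\<close> is homogeneous for the torus action with weight
  \<open>\<alpha> - e\<^sub>j\<close>, and different weights are orthogonal. The hypothesis expresses
  \<open>\<alpha> - e\<^sub>j \<noteq> \<beta> - e\<^sub>k\<close> without subtraction.\<close>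

lemma canonical_solution_orthogonal:
  assumes "increment \<alpha> k \<noteq> increment \<beta> j"
  shows "L2_inner \<mu> (canonical_solution \<alpha> j) (canonical_solution \<beta> k) = 0"
proof -
  have "\<alpha> j = 0 \<or> increment (decrement \<alpha> j) k \<noteq> \<beta>"
  proof (rule ccontr)
    assume "\<not> ?thesis"
    then have "increment (increment (decrement \<alpha> j) j) k = increment \<beta> j" and "\<alpha> j \<noteq> 0"
      using increment_commute[of "decrement \<alpha> j" j k] by auto
    with assms show False
      by (simp only: increment_decrement not_False_eq_True)
  qed
  with assms show ?thesis
    by (auto simp: L2_inner_canonical_solution L2_inner_monomial)
qed

text \<open>The quotient of the squared norms of \<open>canonical_solution \<alpha> j\<close> and of the form
  \<open>z\<^sup>\<alpha> dz\<^sub>j\<^sup>*\<close> that it solves.\<close>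

definition solution_ratio :: "('n \<Rightarrow> nat) \<Rightarrow> 'n \<Rightarrow> real" where
  "solution_ratio \<alpha> j = real (Suc (\<alpha> j)) * moment_ratio (total_degree \<alpha>) -
     real (\<alpha> j) * moment_ratio (total_degree \<alpha> - 1)"

lemma L2_norm_canonical_solution_power2:
  "(L2_norm \<mu> (canonical_solution \<alpha> j))\<^sup>2 = solution_ratio \<alpha> j * monomial_sqnorm \<alpha>"
proof -
  have "complex_of_real ((L2_norm \<mu> (canonical_solution \<alpha> j))\<^sup>2) =
      of_real (monomial_sqnorm (increment \<alpha> j)) -
      of_real (real (\<alpha> j) * moment_ratio (total_degree \<alpha> - 1)) * of_real (monomial_sqnorm \<alpha>)"
    unfolding L2_inner_self[symmetric] L2_inner_canonical_solution L2_inner_monomial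
    by (cases "\<alpha> j = 0") (simp_all add: increment_decrement)
  also have "\<dots> = of_real (solution_ratio \<alpha> j * monomial_sqnorm \<alpha>)"
    by (simp add: monomial_sqnorm_increment solution_ratio_def algebra_simps)
  finally show ?thesis
    using of_real_eq_iff by blast
qed

lemma solution_ratio_nonneg: "0 \<le> solution_ratio \<alpha> j"
proof -
  have "0 \<le> solution_ratio \<alpha> j * monomial_sqnorm \<alpha>"
    by (metis L2_norm_canonical_solution_power2 zero_le_power2)
  then show ?thesis
    using monomial_sqnorm_pos[of \<alpha>] by (simp add: zero_le_mult_iff)
qed

lemma polynomials_L2: "p \<in> polynomials \<Longrightarrow> p \<in> L2 \<mu>"
  by (auto simp: polynomials_def intro!: L2_sum L2_scale L2_monomial)

lemma A2_L2: "f \<in> A2 \<mu> \<Longrightarrow> f \<in> L2 \<mu>"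
  by (simp add: A2_def)

lemma polynomials_A2: "p \<in> polynomials \<Longrightarrow> p \<in> A2 \<mu>"
  by (auto simp: A2_def polynomials_L2 L2_norm_zero intro!: bexI[of _ p])

lemma A2_add_polynomial:
  assumes "f \<in> A2 \<mu>" "p \<in> polynomials"
  shows "(\<lambda>z. f z + p z) \<in> A2 \<mu>"
  unfolding A2_def
proof (intro CollectI conjI allI impI)
  show "(\<lambda>z. f z + p z) \<in> L2 \<mu>"
    using assms by (intro L2_add A2_L2 polynomials_L2)
  fix e :: real assume "e > 0"
  then obtain q where q: "q \<in> polynomials" "L2_norm \<mu> (\<lambda>z. f z - q z) < e"
    using assms(1) by (auto simp: A2_def)
  show "\<exists>r\<in>polynomials. r \<in> L2 \<mu> \<and> L2_norm \<mu> (\<lambda>z. f z + p z - r z) < e"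
    using q assms(2) by (intro bexI[of _ "\<lambda>z. q z + p z"] conjI polynomials_L2 polynomials_add) auto
qed

lemma orthogonal_A2:
  assumes f: "f \<in> L2 \<mu>" and orth: "\<And>\<beta>. L2_inner \<mu> f (monomial \<beta>) = 0" and g: "g \<in> A2 \<mu>"
  shows "L2_inner \<mu> f g = 0"
proof -
  have poly: "L2_inner \<mu> f p = 0" if p: "p \<in> polynomials" for p
  proof -
    obtain A c where "p = (\<lambda>z. \<Sum>\<alpha>\<in>A. c \<alpha> * monomial \<alpha> z)"
      using p by (auto simp: polynomials_def)
    then show ?thesis
      by (simp add: L2_inner_sum_right L2_scale L2_monomial f L2_inner_scale_right orth)
  qed
  have "cmod (L2_inner \<mu> f g) \<le> e" if "e > 0" for e
  proof -
    have "L2_norm \<mu> f + 1 > 0"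
      using L2_norm_nonneg[of \<mu> f] by linarith
    with \<open>e > 0\<close> have "e / (L2_norm \<mu> f + 1) > 0"
      by simp
    then obtain p where p: "p \<in> polynomials" "L2_norm \<mu> (\<lambda>z. g z - p z) < e / (L2_norm \<mu> f + 1)"
      using g by (auto simp: A2_def)
    note L2 = A2_L2[OF g] polynomials_L2[OF p(1)]
    have "L2_inner \<mu> f g = L2_inner \<mu> f (\<lambda>z. g z - p z)"
      using poly[OF p(1)] L2 f by (simp add: L2_inner_diff_right)
    also have "cmod \<dots> \<le> L2_norm \<mu> f * L2_norm \<mu> (\<lambda>z. g z - p z)"
      by (intro L2_Cauchy_Schwarz f L2_diff L2)
    also have "\<dots> \<le> (L2_norm \<mu> f + 1) * (e / (L2_norm \<mu> f + 1))"
      using p(2) L2_norm_nonneg[of \<mu>] by (intro mult_mono) auto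
    also have "\<dots> = e"
      using \<open>L2_norm \<mu> f + 1 > 0\<close> by simp
    finally show ?thesis .
  qed
  then show ?thesis
    by (metis dense norm_le_zero_iff not_le)
qed

text \<open>The Cauchy-Schwarz inequality for \<open>|z|\<^sup>d\<close> and \<open>|z|\<^sup>d\<^sup>+\<^sup>2\<close>.\<close>

lemma moment_log_convex: "(moment \<mu> (Suc d))\<^sup>2 \<le> moment \<mu> d * moment \<mu> (Suc (Suc d))"
proof -
  define f where "f m z = complex_of_real (norm z ^ m)" for m and z :: "complex^'n"
  have f: "f m \<in> L2 \<mu>" and nf: "(L2_norm \<mu> (f m))\<^sup>2 = moment \<mu> m" for m
  proof -
    have "f m \<in> borel_measurable \<mu>"
      unfolding borel_measurable_eq f_def[abs_def] by measurable
    then show "f m \<in> L2 \<mu>"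
      using integrable_moment[of m] by (simp add: L2_def f_def norm_power power_mult mult.commute[of 2])
    show "(L2_norm \<mu> (f m))\<^sup>2 = moment \<mu> m"
      by (simp add: L2_norm_power2 moment_def f_def norm_power power_mult mult.commute[of 2])
  qed
  have "moment \<mu> (Suc d) = (LINT z|\<mu>. cmod (f d z) * cmod (f (Suc (Suc d)) z))"
  proof -
    have "norm z ^ (2 * Suc d) = cmod (f d z) * cmod (f (Suc (Suc d)) z)" for z
    proof -
      have "cmod (f m z) = norm z ^ m" for m
        unfolding f_def norm_of_real by simp
      moreover have "2 * Suc d = d + Suc (Suc d)"
        by simp
      ultimately show ?thesis
        by (simp only: power_add)
    qed
    then show ?thesis
      by (simp only: moment_def)
  qed
  also have "\<dots> \<le> L2_norm \<mu> (f d) * L2_norm \<mu> (f (Suc (Suc d)))"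
    by (intro L2_Cauchy_Schwarz_abs(2) f)
  finally have "(moment \<mu> (Suc d))\<^sup>2 \<le> (L2_norm \<mu> (f d) * L2_norm \<mu> (f (Suc (Suc d))))\<^sup>2"
    using moment_pos[of "Suc d"] by (intro power_mono) auto
  then show ?thesis
    by (simp add: power_mult_distrib nf)
qed

end

section \<open>The block decomposition\<close>

text \<open>The weight \<open>\<alpha> - e\<^sub>j\<close> of the canonical solution for \<open>z\<^sup>\<alpha> dz\<^sub>j\<^sup>*\<close>. Its entries are integers because
  the entry at \<open>j\<close> is \<open>-1\<close> when \<open>\<alpha>\<^sub>j = 0\<close>.\<close>

definition block_index :: "('n \<Rightarrow> nat) \<times> 'n \<Rightarrow> 'n \<Rightarrow> int" where
  "block_index i l = int (fst i l) - (if l = snd i then 1 else 0)"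

lemma block_index_eqI:
  assumes "increment \<alpha> k = increment \<beta> j"
  shows "block_index (\<alpha>, j) = block_index (\<beta>, k)"
proof
  fix l
  show "block_index (\<alpha>, j) l = block_index (\<beta>, k) l"
    using fun_cong[OF assms, of l] by (auto simp: block_index_def split: if_splits)
qed

lemma block_index_eq_same: "block_index (\<alpha>, j) = block_index (\<beta>, j) \<Longrightarrow> \<alpha> = \<beta>"
  by (auto simp: fun_eq_iff block_index_def)

lemma sum_block_index: "(\<Sum>l\<in>UNIV. block_index i l) = int (total_degree (fst i)) - 1"
  by (simp add: block_index_def total_degree_def sum_subtractf)

context rotation_invariant_measure
begin

text \<open>For \<open>d > 0\<close> this is the trace of \<open>S\<^sup>*S\<close> on a block of forms of degree \<open>d\<close> whose index has no
  negative entry. In degree \<open>0\<close> every block consists of one constant form, and the value is its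
  solution ratio.\<close>

definition block_trace :: "nat \<Rightarrow> real" where
  "block_trace d = (if d = 0 then moment_ratio 0 else
     (2 * real CARD('n) + real d - 1) * moment_ratio d -
     (real CARD('n) + real d - 1) * moment_ratio (d - 1))"

lemma sum_solution_ratio:
  assumes "total_degree \<gamma> = d"
  shows "(\<Sum>j\<in>UNIV. solution_ratio (increment \<gamma> j) j) = block_trace (Suc d)"
proof -
  have "(\<Sum>j\<in>UNIV. real (\<gamma> j)) = real d"
    using assms by (simp add: total_degree_def flip: of_nat_sum)
  moreover have "solution_ratio (increment \<gamma> j) j =
      (real (\<gamma> j) + 2) * moment_ratio (Suc d) - (real (\<gamma> j) + 1) * moment_ratio d" for j
    using assms by (simp add: solution_ratio_def total_degree_increment add.commute)
  ultimately show ?thesis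
    by (simp add: block_trace_def sum_subtractf sum.distrib ac_simps
        flip: sum_distrib_left sum_distrib_right)
qed

text \<open>For \<open>d > 0\<close> the difference is \<open>m\<^sub>d\<^sub>+\<^sub>1 / m\<^sub>d - m\<^sub>d / m\<^sub>d\<^sub>-\<^sub>1\<close>, which is nonnegative by log-convexity, plus
  \<open>n - 2\<close> times \<open>moment_ratio d\<close>.\<close>

lemma moment_ratio_le_block_trace:
  assumes "d = 0 \<or> 2 \<le> CARD('n)"
  shows "moment_ratio d \<le> block_trace d"
proof (cases d)
  case 0
  then show ?thesis by (simp add: block_trace_def)
next
  case (Suc e)
  let ?n = "real CARD('n)"
  have n: "2 \<le> ?n"
    using assms Suc by simp
  have q: "(?n + real k) * moment_ratio k = moment \<mu> (Suc k) / moment \<mu> k" for k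
  proof -
    have "?n + real k \<noteq> 0" using n by linarith
    then show ?thesis by (simp add: moment_ratio_def)
  qed
  have "moment \<mu> (Suc e) / moment \<mu> e \<le> moment \<mu> (Suc (Suc e)) / moment \<mu> (Suc e)"
    using moment_log_convex[of e] moment_pos[of e] moment_pos[of "Suc e"]
    by (simp add: field_simps power2_eq_square)
  then have "(?n + real e) * moment_ratio e \<le> (?n + real (Suc e)) * moment_ratio (Suc e)"
    unfolding q .
  moreover have "1 * moment_ratio (Suc e) \<le> (?n - 1) * moment_ratio (Suc e)"
    using n moment_ratio_pos[of "Suc e"] by (intro mult_right_mono) auto
  ultimately show ?thesis
    unfolding Suc by (simp add: block_trace_def algebra_simps)
qed

text \<open>If the index \<open>g\<close> is negative at \<open>j\<close>, then \<open>J\<close> consists of one pair \<open>(\<alpha>, j)\<close> with \<open>\<alpha>\<^sub>j = 0\<close>, and the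
  sum is \<open>moment_ratio d\<close>; here \<open>d > 0\<close> forces a second coordinate, so \<open>n \<ge> 2\<close>. Otherwise \<open>g\<close> is a
  multi-index \<open>\<gamma>\<close>, and \<open>J\<close> is part of the family of all \<open>(\<gamma> + e\<^sub>j, j)\<close>.\<close>

lemma sum_solution_ratio_block_le:
  assumes J: "J \<noteq> {}" "\<And>i. i \<in> J \<Longrightarrow> block_index i = g"
    and d: "\<And>i. i \<in> J \<Longrightarrow> total_degree (fst i) = d"
  shows "(\<Sum>i\<in>J. solution_ratio (fst i) (snd i)) \<le> block_trace d"
proof (cases "\<exists>j. g j < 0")
  case True
  then obtain j where j: "g j < 0" by blast
  have i: "snd i = j \<and> fst i j = 0" if "i \<in> J" for i
    using j J(2)[OF that] by (auto simp: block_index_def split: if_splits)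
  obtain i where "i \<in> J" using J(1) by blast
  obtain \<alpha> where \<alpha>: "i = (\<alpha>, j)" "\<alpha> j = 0"
    using i[OF \<open>i \<in> J\<close>] by (cases i) auto
  have "i' = i" if i': "i' \<in> J" for i'
  proof -
    obtain \<beta> where \<beta>: "i' = (\<beta>, j)"
      using i[OF i'] by (cases i') auto
    have "block_index (\<beta>, j) = block_index (\<alpha>, j)"
      using J(2)[OF i'] J(2)[OF \<open>i \<in> J\<close>] \<alpha> \<beta> by simp
    then have "\<beta> = \<alpha>"
      by (rule block_index_eq_same)
    then show ?thesis
      using \<alpha> \<beta> by simp
  qed
  with \<open>i \<in> J\<close> have "J = {i}" by blast
  then have "(\<Sum>i\<in>J. solution_ratio (fst i) (snd i)) = moment_ratio d"
    using \<alpha> d[OF \<open>i \<in> J\<close>] by (simp add: solution_ratio_def)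
  also have "\<dots> \<le> block_trace d"
  proof (rule moment_ratio_le_block_trace)
    have "2 \<le> CARD('n)" if "d \<noteq> 0"
    proof -
      have "total_degree \<alpha> \<noteq> 0"
        using d[OF \<open>i \<in> J\<close>] \<alpha> that by simp
      then obtain k where "\<alpha> k \<noteq> 0"
        unfolding total_degree_def by (metis sum.neutral)
      then have "k \<noteq> j" using \<alpha> by auto
      then have "card {j, k} = 2" by simp
      then show ?thesis
        by (metis card_mono finite_class.finite_UNIV subset_UNIV)
    qed
    then show "d = 0 \<or> 2 \<le> CARD('n)" by blast
  qed
  finally show ?thesis .
next
  case False
  define \<gamma> where "\<gamma> j = nat (g j)" for j
  have g: "g j = int (\<gamma> j)" for j
    using False by (simp add: \<gamma>_def not_less)
  have mem: "i = (increment \<gamma> (snd i), snd i)" if "i \<in> J" for i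
  proof -
    have "int (fst i l) = int (increment \<gamma> (snd i) l)" for l
      using fun_cong[OF J(2)[OF that], of l] g[of l] by (auto simp: block_index_def split: if_splits)
    then have "fst i = increment \<gamma> (snd i)"
      by (intro ext) (simp only: of_nat_eq_iff)
    then show ?thesis by (simp add: prod_eq_iff)
  qed
  obtain i where "i \<in> J" using J(1) by blast
  have deg: "Suc (total_degree \<gamma>) = d"
    using d[OF \<open>i \<in> J\<close>] arg_cong[OF mem[OF \<open>i \<in> J\<close>], of fst] total_degree_increment[of \<gamma> "snd i"]
    by simp
  have "inj_on snd J"
    by (rule inj_onI) (metis mem)
  have "(\<Sum>i\<in>J. solution_ratio (fst i) (snd i)) = (\<Sum>i\<in>J. solution_ratio (increment \<gamma> (snd i)) (snd i))"
    by (intro sum.cong refl) (metis mem fst_conv)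
  also have "\<dots> = (\<Sum>j\<in>snd ` J. solution_ratio (increment \<gamma> j) j)"
    using \<open>inj_on snd J\<close> by (simp add: sum.reindex)
  also have "\<dots> \<le> (\<Sum>j\<in>UNIV. solution_ratio (increment \<gamma> j) j)"
    by (intro sum_mono2) (auto intro: solution_ratio_nonneg)
  also have "\<dots> = block_trace d"
    using sum_solution_ratio[of \<gamma>] deg by simp
  finally show ?thesis .
qed

definition solution_sum ::
    "(('n \<Rightarrow> nat) \<times> 'n) set \<Rightarrow> (('n \<Rightarrow> nat) \<times> 'n \<Rightarrow> complex) \<Rightarrow> complex^'n \<Rightarrow> complex" where
  "solution_sum I x z = (\<Sum>i\<in>I. x i * canonical_solution (fst i) (snd i) z)"

lemma L2_solution_sum: "solution_sum I x \<in> L2 \<mu>"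
  unfolding solution_sum_def[abs_def] by (intro L2_sum L2_scale L2_canonical_solution)

text \<open>The norm of a positive operator is at most its trace: for the block this is the Cauchy-Schwarz
  inequality for sums, with the coefficients and the solutions both normalised by
  \<open>\<parallel>z\<^sup>\<alpha>\<parallel>\<close>.\<close>

lemma solution_sum_block_le:
  assumes "finite J" "J \<noteq> {}" "\<And>i. i \<in> J \<Longrightarrow> block_index i = g"
    and "\<And>i. i \<in> J \<Longrightarrow> total_degree (fst i) = d"
  shows "(L2_norm \<mu> (solution_sum J x))\<^sup>2 \<le>
    block_trace d * (\<Sum>i\<in>J. (cmod (x i))\<^sup>2 * monomial_sqnorm (fst i))"
proof -
  let ?s = "\<lambda>i. canonical_solution (fst i) (snd i)" and ?c = "\<lambda>i. monomial_sqnorm (fst i)"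
  have "L2_norm \<mu> (solution_sum J x) \<le> (\<Sum>i\<in>J. L2_norm \<mu> (\<lambda>z. x i * ?s i z))"
    unfolding solution_sum_def[abs_def]
    by (intro L2_norm_sum_le L2_scale L2_canonical_solution)
  also have "\<dots> = (\<Sum>i\<in>J. (cmod (x i) * sqrt (?c i)) * (L2_norm \<mu> (?s i) / sqrt (?c i)))"
    using monomial_sqnorm_pos less_imp_neq[OF monomial_sqnorm_pos]
    by (intro sum.cong) (auto simp: L2_norm_scale)
  finally have "(L2_norm \<mu> (solution_sum J x))\<^sup>2 \<le>
      (\<Sum>i\<in>J. (cmod (x i) * sqrt (?c i)) * (L2_norm \<mu> (?s i) / sqrt (?c i)))\<^sup>2"
    by (intro power_mono L2_norm_nonneg)
  also have "\<dots> \<le> (\<Sum>i\<in>J. (cmod (x i) * sqrt (?c i))\<^sup>2) * (\<Sum>i\<in>J. (L2_norm \<mu> (?s i) / sqrt (?c i))\<^sup>2)"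
    by (rule Cauchy_Schwarz_ineq_sum)
  also have "(\<Sum>i\<in>J. (cmod (x i) * sqrt (?c i))\<^sup>2) = (\<Sum>i\<in>J. (cmod (x i))\<^sup>2 * ?c i)"
    using less_imp_le[OF monomial_sqnorm_pos] by (intro sum.cong) (auto simp: power_mult_distrib)
  also have "(\<Sum>i\<in>J. (L2_norm \<mu> (?s i) / sqrt (?c i))\<^sup>2) = (\<Sum>i\<in>J. solution_ratio (fst i) (snd i))"
    using less_imp_le[OF monomial_sqnorm_pos] less_imp_neq[OF monomial_sqnorm_pos]
    by (intro sum.cong) (auto simp: power_divide L2_norm_canonical_solution_power2)
  also have "(\<Sum>i\<in>J. (cmod (x i))\<^sup>2 * ?c i) * (\<Sum>i\<in>J. solution_ratio (fst i) (snd i)) \<le>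
      (\<Sum>i\<in>J. (cmod (x i))\<^sup>2 * ?c i) * block_trace d"
    using assms less_imp_le[OF monomial_sqnorm_pos]
    by (intro mult_left_mono sum_solution_ratio_block_le sum_nonneg mult_nonneg_nonneg) auto
  finally show ?thesis
    by (simp add: mult.commute)
qed

text \<open>Different blocks have orthogonal solutions, so that the block estimates add up.\<close>

lemma solution_sum_le:
  assumes I: "finite I" and t: "\<And>i. i \<in> I \<Longrightarrow> block_trace (total_degree (fst i)) \<le> t"
  shows "(L2_norm \<mu> (solution_sum I x))\<^sup>2 \<le> t * (\<Sum>i\<in>I. (cmod (x i))\<^sup>2 * monomial_sqnorm (fst i))"
proof -
  let ?J = "\<lambda>g. {i \<in> I. block_index i = g}"
  have "solution_sum I x = (\<lambda>z. \<Sum>g\<in>block_index ` I. solution_sum (?J g) x z)"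
    unfolding solution_sum_def[abs_def] using I by (intro ext sum.image_gen)
  then have "(L2_norm \<mu> (solution_sum I x))\<^sup>2 =
      (L2_norm \<mu> (\<lambda>z. \<Sum>g\<in>block_index ` I. solution_sum (?J g) x z))\<^sup>2"
    by simp
  also have "\<dots> = (\<Sum>g\<in>block_index ` I. (L2_norm \<mu> (solution_sum (?J g) x))\<^sup>2)"
  proof (intro L2_norm_orthogonal_sum finite_imageI I L2_solution_sum)
    fix g h assume "g \<in> block_index ` I" "h \<in> block_index ` I" "g \<noteq> h"
    have "L2_inner \<mu> (canonical_solution (fst i) (snd i)) (canonical_solution (fst k) (snd k)) = 0"
      if "i \<in> ?J g" "k \<in> ?J h" for i k
      using that \<open>g \<noteq> h\<close> by (intro canonical_solution_orthogonal) (metis (mono_tags, lifting)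
          block_index_eqI mem_Collect_eq prod.collapse)
    then show "L2_inner \<mu> (solution_sum (?J g) x) (solution_sum (?J h) x) = 0"
      unfolding solution_sum_def[abs_def]
      by (subst L2_inner_sum_left L2_inner_sum_right;
          simp add: L2_sum L2_scale L2_canonical_solution L2_inner_sum_right
            L2_inner_scale_left L2_inner_scale_right)
  qed
  also have "\<dots> \<le> (\<Sum>g\<in>block_index ` I. t * (\<Sum>i\<in>?J g. (cmod (x i))\<^sup>2 * monomial_sqnorm (fst i)))"
  proof (rule sum_mono)
    fix g assume "g \<in> block_index ` I"
    then obtain i where i: "i \<in> I" "block_index i = g" by blast
    have "(L2_norm \<mu> (solution_sum (?J g) x))\<^sup>2 \<le> block_trace (total_degree (fst i)) *
        (\<Sum>i\<in>?J g. (cmod (x i))\<^sup>2 * monomial_sqnorm (fst i))"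
    proof (rule solution_sum_block_le)
      fix k assume "k \<in> ?J g"
      then have "int (total_degree (fst k)) - 1 = int (total_degree (fst i)) - 1"
        using i by (simp only: sum_block_index[symmetric] mem_Collect_eq)
      then show "total_degree (fst k) = total_degree (fst i)" by simp
    next
      show "finite (?J g)" using I by simp
      show "?J g \<noteq> {}" using i by blast
      show "\<And>k. k \<in> ?J g \<Longrightarrow> block_index k = g" by simp
    qed
    also have "\<dots> \<le> t * (\<Sum>i\<in>?J g. (cmod (x i))\<^sup>2 * monomial_sqnorm (fst i))"
      using t[OF i(1)] less_imp_le[OF monomial_sqnorm_pos]
      by (intro mult_right_mono sum_nonneg mult_nonneg_nonneg) auto
    finally show "(L2_norm \<mu> (solution_sum (?J g) x))\<^sup>2 \<le>
        t * (\<Sum>i\<in>?J g. (cmod (x i))\<^sup>2 * monomial_sqnorm (fst i))" .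
  qed
  also have "\<dots> = t * (\<Sum>i\<in>I. (cmod (x i))\<^sup>2 * monomial_sqnorm (fst i))"
    unfolding sum_distrib_left[symmetric] using I by (simp flip: sum.image_gen)
  finally show ?thesis .
qed

section \<open>Sufficiency\<close>

definition form_coeff :: "'n form01 \<Rightarrow> ('n \<Rightarrow> nat) \<times> 'n \<Rightarrow> complex" where
  "form_coeff \<omega> i = L2_inner \<mu> (\<omega> (snd i)) (monomial (fst i)) / of_real (monomial_sqnorm (fst i))"

definition L2_forms :: "'n form01 set" where
  "L2_forms = {\<omega>. \<forall>j. \<omega> j \<in> L2 \<mu>}"

lemma form_coeff_lincomb:
  assumes "\<omega> \<in> L2_forms" "\<eta> \<in> L2_forms"
  shows "form_coeff (\<lambda>j z. a * \<omega> j z + b * \<eta> j z) i = a * form_coeff \<omega> i + b * form_coeff \<eta> i"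
  using assms by (simp add: form_coeff_def L2_forms_def L2_inner_add_left L2_scale L2_monomial
      L2_inner_scale_left add_divide_distrib)

lemma form_coeff_cong_AE:
  assumes "\<omega> \<in> L2_forms" "\<eta> \<in> L2_forms" "\<And>j. AE z in \<mu>. \<omega> j z = \<eta> j z"
  shows "form_coeff \<omega> = form_coeff \<eta>"
proof
  fix i
  have "L2_inner \<mu> (\<omega> (snd i)) (monomial (fst i)) = L2_inner \<mu> (\<eta> (snd i)) (monomial (fst i))"
    using assms by (intro L2_inner_cong_AE) (auto simp: L2_forms_def L2_measurable)
  then show "form_coeff \<omega> i = form_coeff \<eta> i"
    by (simp add: form_coeff_def)
qed

lemma Bessel_monomials:
  assumes f: "f \<in> L2 \<mu>" and A: "finite A"
  shows "(\<Sum>\<alpha>\<in>A. (cmod (L2_inner \<mu> f (monomial \<alpha>) / of_real (monomial_sqnorm \<alpha>)))\<^sup>2 * monomial_sqnorm \<alpha>)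
    \<le> (L2_norm \<mu> f)\<^sup>2"
proof -
  define c where "c \<alpha> = L2_inner \<mu> f (monomial \<alpha>) / of_real (monomial_sqnorm \<alpha>)" for \<alpha>
  define p where "p z = (\<Sum>\<alpha>\<in>A. c \<alpha> * monomial \<alpha> z)" for z
  let ?S = "\<Sum>\<alpha>\<in>A. (cmod (c \<alpha>))\<^sup>2 * monomial_sqnorm \<alpha>"
  have p: "p \<in> L2 \<mu>"
    unfolding p_def[abs_def] by (intro L2_sum L2_scale L2_monomial)
  have np: "(L2_norm \<mu> p)\<^sup>2 = ?S"
  proof -
    have "(L2_norm \<mu> p)\<^sup>2 = (\<Sum>\<alpha>\<in>A. (L2_norm \<mu> (\<lambda>z. c \<alpha> * monomial \<alpha> z))\<^sup>2)"
      unfolding p_def[abs_def]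
      by (rule L2_norm_orthogonal_sum[OF A])
        (auto simp: L2_inner_scale_left L2_inner_scale_right L2_inner_monomial intro: L2_scale L2_monomial)
    then show ?thesis
      by (simp add: L2_norm_scale power_mult_distrib L2_norm_monomial_power2)
  qed
  have "L2_inner \<mu> f p = (\<Sum>\<alpha>\<in>A. cnj (c \<alpha>) * L2_inner \<mu> f (monomial \<alpha>))"
    unfolding p_def[abs_def]
    by (simp add: L2_inner_sum_right L2_scale L2_monomial f L2_inner_scale_right)
  also have "\<dots> = (\<Sum>\<alpha>\<in>A. of_real ((cmod (c \<alpha>))\<^sup>2 * monomial_sqnorm \<alpha>))"
  proof (intro sum.cong refl)
    fix \<alpha>
    have "L2_inner \<mu> f (monomial \<alpha>) = c \<alpha> * of_real (monomial_sqnorm \<alpha>)"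
      using monomial_sqnorm_pos[of \<alpha>] by (simp add: c_def)
    then show "cnj (c \<alpha>) * L2_inner \<mu> f (monomial \<alpha>) = of_real ((cmod (c \<alpha>))\<^sup>2 * monomial_sqnorm \<alpha>)"
      by (simp only: of_real_mult complex_norm_square mult_ac)
  qed
  also have "\<dots> = L2_inner \<mu> p p"
    unfolding L2_inner_self np by (simp only: of_real_sum)
  finally have fp: "L2_inner \<mu> (\<lambda>z. f z - p z) p = 0"
    by (simp add: L2_inner_diff_left f p)
  \<comment> \<open>\<open>f\<close> is the difference of the orthogonal functions \<open>f - p\<close> and \<open>-p\<close>\<close>
  have "(L2_norm \<mu> f)\<^sup>2 = (L2_norm \<mu> (\<lambda>z. (f z - p z) - (-1) * p z))\<^sup>2"
    by simp
  also have "\<dots> = (L2_norm \<mu> (\<lambda>z. f z - p z))\<^sup>2 + (L2_norm \<mu> (\<lambda>z. (-1) * p z))\<^sup>2"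
    using fp by (intro L2_norm_diff_orthogonal L2_diff L2_scale f p) (simp only: L2_inner_scale_right mult_zero_right)
  also have "\<dots> = (L2_norm \<mu> (\<lambda>z. f z - p z))\<^sup>2 + ?S"
    unfolding L2_norm_scale by (simp add: np)
  finally show ?thesis
    by (simp add: c_def)
qed

lemma form01_norm_power2: "(form01_norm \<mu> \<omega>)\<^sup>2 = (\<Sum>j\<in>UNIV. (L2_norm \<mu> (\<omega> j))\<^sup>2)"
  by (simp add: form01_norm_def sum_nonneg)

lemma form01_norm_nonneg: "0 \<le> form01_norm \<mu> \<omega>"
  by (simp add: form01_norm_def sum_nonneg)

lemma Bessel_form:
  assumes \<omega>: "\<omega> \<in> L2_forms" and I: "finite I"
  shows "(\<Sum>i\<in>I. (cmod (form_coeff \<omega> i))\<^sup>2 * monomial_sqnorm (fst i)) \<le> (form01_norm \<mu> \<omega>)\<^sup>2"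
proof -
  let ?f = "\<lambda>i. (cmod (form_coeff \<omega> i))\<^sup>2 * monomial_sqnorm (fst i)"
  have "(\<Sum>i\<in>I. ?f i) \<le> (\<Sum>i\<in>fst ` I \<times> UNIV. ?f i)"
  proof (rule sum_mono2)
    show "I \<subseteq> fst ` I \<times> UNIV"
      by force
    show "finite (fst ` I \<times> (UNIV :: 'n set))"
      using I by simp
    show "\<And>i. 0 \<le> ?f i"
      using less_imp_le[OF monomial_sqnorm_pos] by simp
  qed
  also have "\<dots> = (\<Sum>j\<in>UNIV. \<Sum>\<alpha>\<in>fst ` I. ?f (\<alpha>, j))"
    by (subst sum.swap) (simp add: sum.cartesian_product split_def)
  also have "\<dots> \<le> (\<Sum>j\<in>UNIV. (L2_norm \<mu> (\<omega> j))\<^sup>2)"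
    using \<omega> I Bessel_monomials
    by (intro sum_mono) (simp add: form_coeff_def L2_forms_def)
  finally show ?thesis
    by (simp only: form01_norm_power2)
qed

definition indices_below :: "nat \<Rightarrow> (('n \<Rightarrow> nat) \<times> 'n) set" where
  "indices_below N = {i. total_degree (fst i) < N}"

lemma finite_indices_below: "finite (indices_below N)"
proof -
  have "indices_below N \<subseteq> (PiE UNIV (\<lambda>_. {..<N})) \<times> UNIV"
  proof
    fix i :: "('n \<Rightarrow> nat) \<times> 'n" assume "i \<in> indices_below N"
    moreover have "fst i l \<le> total_degree (fst i)" for l
      unfolding total_degree_def by (rule member_le_sum) auto
    ultimately have "fst i l < N" for l
      unfolding indices_below_def using le_less_trans by blast
    then show "i \<in> (PiE UNIV (\<lambda>_. {..<N})) \<times> UNIV"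
      by (cases i) (auto simp: PiE_UNIV_domain)
  qed
  then show ?thesis
    by (rule finite_subset) (intro finite_cartesian_product finite_PiE; simp)
qed

text \<open>The canonical solution for the truncation of \<open>\<omega>\<close> to coefficients of degree less than \<open>N\<close>. The
  solution for \<open>\<omega>\<close> itself is obtained as the limit, since neither \<open>S\<close> nor multiplication by
  \<open>z\<^sub>j\<^sup>*\<close> is defined on all of \<open>L\<^sup>2\<close> beforehand.\<close>

definition partial_solution :: "nat \<Rightarrow> 'n form01 \<Rightarrow> complex^'n \<Rightarrow> complex" where
  "partial_solution N \<omega> = solution_sum (indices_below N) (form_coeff \<omega>)"

lemma L2_partial_solution: "partial_solution N \<omega> \<in> L2 \<mu>"
  unfolding partial_solution_def by (rule L2_solution_sum)

lemma partial_solution_tail: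
  assumes \<omega>: "\<omega> \<in> L2_forms" and t: "0 \<le> t" "\<And>d. d \<ge> N \<Longrightarrow> block_trace d \<le> t" and "N \<le> M"
  shows "L2_norm \<mu> (\<lambda>z. partial_solution M \<omega> z - partial_solution N \<omega> z) \<le> sqrt t * form01_norm \<mu> \<omega>"
proof -
  let ?I = "indices_below M - indices_below N"
  have "indices_below N \<subseteq> indices_below M"
    using \<open>N \<le> M\<close> by (auto simp: indices_below_def)
  then have eq: "(\<lambda>z. partial_solution M \<omega> z - partial_solution N \<omega> z) = solution_sum ?I (form_coeff \<omega>)"
    by (simp add: partial_solution_def solution_sum_def[abs_def] sum_diff finite_indices_below)
  have "(L2_norm \<mu> (\<lambda>z. partial_solution M \<omega> z - partial_solution N \<omega> z))\<^sup>2 \<le>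
      t * (\<Sum>i\<in>?I. (cmod (form_coeff \<omega> i))\<^sup>2 * monomial_sqnorm (fst i))"
    unfolding eq
  proof (rule solution_sum_le)
    show "finite ?I"
      by (simp add: finite_indices_below)
    show "\<And>i. i \<in> ?I \<Longrightarrow> block_trace (total_degree (fst i)) \<le> t"
      using t(2) by (simp add: indices_below_def)
  qed
  also have "\<dots> \<le> t * (form01_norm \<mu> \<omega>)\<^sup>2"
    using Bessel_form[OF \<omega>, of ?I] t(1) by (intro mult_left_mono) (auto simp: finite_indices_below)
  also have "\<dots> = (sqrt t * form01_norm \<mu> \<omega>)\<^sup>2"
    using t(1) by (simp add: power_mult_distrib)
  finally show ?thesis
    by (rule power2_le_imp_le) (simp add: t(1) form01_norm_nonneg)
qed

end

context rotation_invariant_measure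
begin

text \<open>The choice of the limit depends on \<open>\<omega>\<close> only through its coefficients. Forms that agree almost
  everywhere therefore have equal images.\<close>

definition solution_operator :: "'n form01 \<Rightarrow> complex^'n \<Rightarrow> complex" where
  "solution_operator \<omega> = (SOME g. g \<in> L2 \<mu> \<and>
     (\<lambda>N. L2_norm \<mu> (\<lambda>z. partial_solution N \<omega> z - g z)) \<longlonglongrightarrow> 0)"

lemma A2_form01_L2_forms: "A2_form01 \<mu> \<subseteq> L2_forms"
  by (auto simp: A2_form01_def L2_forms_def A2_L2)

lemma polynomial_form01_L2_forms: "polynomial_form01 \<subseteq> L2_forms"
  by (auto simp: polynomial_form01_def L2_forms_def polynomials_L2)

lemma monomial_form01_apply:
  "monomial_form01 \<alpha> j k = (if k = j then monomial \<alpha> else (\<lambda>z. 0 * monomial \<alpha> z))"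
  by (auto simp: monomial_form01_def)

lemma monomial_form01_polynomial: "monomial_form01 \<alpha> j \<in> polynomial_form01"
  using polynomial_monomial[of 0 \<alpha>] polynomial_monomial[of 1 \<alpha>]
  by (simp add: polynomial_form01_def monomial_form01_apply)

lemma form_coeff_monomial_form01:
  "form_coeff (monomial_form01 \<alpha> j) i = (if i = (\<alpha>, j) then 1 else 0)"
proof -
  have "L2_inner \<mu> (monomial_form01 \<alpha> j (snd i)) (monomial (fst i)) =
      (if i = (\<alpha>, j) then of_real (monomial_sqnorm \<alpha>) else 0)"
    by (cases i) (auto simp: monomial_form01_apply L2_inner_monomial L2_inner_def[of _ "\<lambda>z. 0"])
  then show ?thesis
    using monomial_sqnorm_pos[of \<alpha>] by (simp add: form_coeff_def)
qed

lemma partial_solution_monomial_form01: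
  assumes "total_degree \<alpha> < N"
  shows "partial_solution N (monomial_form01 \<alpha> j) = canonical_solution \<alpha> j"
proof
  fix z
  have "partial_solution N (monomial_form01 \<alpha> j) z =
      (\<Sum>i\<in>indices_below N. if i = (\<alpha>, j) then canonical_solution \<alpha> j z else 0)"
    unfolding partial_solution_def solution_sum_def
    by (intro sum.cong) (auto simp: form_coeff_monomial_form01)
  also have "\<dots> = canonical_solution \<alpha> j z"
    using assms by (subst sum.delta[OF finite_indices_below]) (simp add: indices_below_def)
  finally show "partial_solution N (monomial_form01 \<alpha> j) z = canonical_solution \<alpha> j z" .
qed

context
  assumes trace_null: "block_trace \<longlonglongrightarrow> 0"
begin

lemma block_trace_eventually_le:
  assumes "t > 0"
  obtains N where "\<And>d. d \<ge> N \<Longrightarrow> block_trace d \<le> t"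
proof -
  have "\<forall>\<^sub>F d in sequentially. block_trace d < t"
    using order_tendstoD(2)[OF trace_null assms] .
  then obtain N where "\<And>d. d \<ge> N \<Longrightarrow> block_trace d < t"
    by (auto simp: eventually_sequentially)
  then show ?thesis
    using that less_imp_le by blast
qed

text \<open>Once the block traces are below \<open>t\<close>, later truncations change the solution by at most
  \<open>\<surd>t \<parallel>\<omega>\<parallel>\<close>, so the partial solutions form a Cauchy sequence.\<close>

lemma solution_operator_limit:
  assumes \<omega>: "\<omega> \<in> L2_forms"
  shows "solution_operator \<omega> \<in> L2 \<mu>"
    and "(\<lambda>N. L2_norm \<mu> (\<lambda>z. partial_solution N \<omega> z - solution_operator \<omega> z)) \<longlonglongrightarrow> 0"
proof -
  have Cauchy: "\<exists>N. \<forall>k\<ge>N. \<forall>l\<ge>N. L2_norm \<mu> (\<lambda>z. partial_solution k \<omega> z - partial_solution l \<omega> z) < e"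
    if "e > 0" for e
  proof -
    define B where "B = form01_norm \<mu> \<omega> + 1"
    have B: "B > 0" "form01_norm \<mu> \<omega> < B"
      using form01_norm_nonneg[of \<omega>] by (auto simp: B_def)
    define t where "t = (e / B)\<^sup>2"
    have t: "t > 0" "sqrt t * form01_norm \<mu> \<omega> < e"
    proof -
      show "t > 0" using that B by (simp add: t_def)
      have "(e / B) * form01_norm \<mu> \<omega> < (e / B) * B"
        using that B by (intro mult_strict_left_mono) auto
      then show "sqrt t * form01_norm \<mu> \<omega> < e"
        using that B by (simp add: t_def real_sqrt_divide)
    qed
    obtain N where N: "\<And>d. d \<ge> N \<Longrightarrow> block_trace d \<le> t"
      using block_trace_eventually_le[OF t(1)] by blast
    have le: "L2_norm \<mu> (\<lambda>z. partial_solution k \<omega> z - partial_solution l \<omega> z) < e"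
      if "N \<le> l" "l \<le> k" for k l
    proof -
      have "L2_norm \<mu> (\<lambda>z. partial_solution k \<omega> z - partial_solution l \<omega> z) \<le> sqrt t * form01_norm \<mu> \<omega>"
      proof (rule partial_solution_tail[OF \<omega> less_imp_le[OF t(1)] _ that(2)])
        show "block_trace d \<le> t" if "l \<le> d" for d
          using that \<open>N \<le> l\<close> by (intro N) simp
      qed
      with t(2) show ?thesis by linarith
    qed
    have "L2_norm \<mu> (\<lambda>z. partial_solution k \<omega> z - partial_solution l \<omega> z) < e"
      if "N \<le> l" "N \<le> k" for k l
      using le[of l k] le[of k l] that L2_norm_minus_commute[of \<mu> "partial_solution k \<omega>" "partial_solution l \<omega>"]
      by (cases "l \<le> k") auto
    then show ?thesis by blast
  qed
  have "\<exists>g. g \<in> L2 \<mu> \<and> (\<lambda>N. L2_norm \<mu> (\<lambda>z. partial_solution N \<omega> z - g z)) \<longlonglongrightarrow> 0"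
    by (rule L2_complete[OF finite_measure L2_partial_solution]) (erule Cauchy, blast)
  from someI_ex[OF this]
  show "solution_operator \<omega> \<in> L2 \<mu>"
    and "(\<lambda>N. L2_norm \<mu> (\<lambda>z. partial_solution N \<omega> z - solution_operator \<omega> z)) \<longlonglongrightarrow> 0"
    unfolding solution_operator_def by blast+
qed

lemma solution_operator_tail:
  assumes \<omega>: "\<omega> \<in> L2_forms" and t: "0 \<le> t" "\<And>d. d \<ge> N \<Longrightarrow> block_trace d \<le> t"
  shows "L2_norm \<mu> (\<lambda>z. solution_operator \<omega> z - partial_solution N \<omega> z) \<le> sqrt t * form01_norm \<mu> \<omega>"
proof (rule LIMSEQ_le_const2)
  show "(\<lambda>M. L2_norm \<mu> (\<lambda>z. partial_solution M \<omega> z - partial_solution N \<omega> z))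
      \<longlonglongrightarrow> L2_norm \<mu> (\<lambda>z. solution_operator \<omega> z - partial_solution N \<omega> z)"
    using solution_operator_limit[OF \<omega>]
    by (intro L2_norm_tendsto) (auto intro: L2_diff L2_partial_solution)
  show "\<exists>K. \<forall>M\<ge>K. L2_norm \<mu> (\<lambda>z. partial_solution M \<omega> z - partial_solution N \<omega> z) \<le> sqrt t * form01_norm \<mu> \<omega>"
    using partial_solution_tail[OF \<omega> t] by blast
qed

lemma linear_solution_operator:
  assumes D: "D \<subseteq> L2_forms"
  shows "linear_form01_operator \<mu> D solution_operator"
  unfolding linear_form01_operator_def
proof (intro conjI ballI allI impI)
  fix \<omega> assume "\<omega> \<in> D"
  then show "solution_operator \<omega> \<in> L2 \<mu>"
    using D solution_operator_limit by blast
next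
  fix \<omega> \<eta> assume "\<omega> \<in> D" "\<eta> \<in> D" "\<forall>j. AE z in \<mu>. \<omega> j z = \<eta> j z"
  then have "form_coeff \<omega> = form_coeff \<eta>"
    using D by (intro form_coeff_cong_AE) auto
  then show "AE z in \<mu>. solution_operator \<omega> z = solution_operator \<eta> z"
    by (simp add: solution_operator_def partial_solution_def)
next
  fix \<omega> \<eta> a b assume "\<omega> \<in> D" "\<eta> \<in> D"
  then have \<omega>: "\<omega> \<in> L2_forms" and \<eta>: "\<eta> \<in> L2_forms"
    using D by auto
  let ?\<zeta> = "\<lambda>j z. a * \<omega> j z + b * \<eta> j z"
  let ?g = "\<lambda>z. a * solution_operator \<omega> z + b * solution_operator \<eta> z"
  have \<zeta>: "?\<zeta> \<in> L2_forms"
    using \<omega> \<eta> by (simp add: L2_forms_def L2_add L2_scale)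
  have part: "partial_solution N ?\<zeta> z = a * partial_solution N \<omega> z + b * partial_solution N \<eta> z" for N z
    unfolding partial_solution_def solution_sum_def form_coeff_lincomb[OF \<omega> \<eta>]
    by (simp add: distrib_right sum.distrib sum_distrib_left mult.assoc)
  note L2 = solution_operator_limit(1)[OF \<omega>] solution_operator_limit(1)[OF \<eta>]
  show "AE z in \<mu>. solution_operator ?\<zeta> z = ?g z"
  proof (rule L2_limit_unique_AE[where F = "\<lambda>N. partial_solution N ?\<zeta>"])
    show "?g \<in> L2 \<mu>"
      by (intro L2_add L2_scale L2)
    show "(\<lambda>N. L2_norm \<mu> (\<lambda>z. partial_solution N ?\<zeta> z - ?g z)) \<longlonglongrightarrow> 0"
    proof (rule tendsto_sandwich[where f = "\<lambda>_. 0"])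
      let ?A = "\<lambda>N. L2_norm \<mu> (\<lambda>z. partial_solution N \<omega> z - solution_operator \<omega> z)"
      let ?B = "\<lambda>N. L2_norm \<mu> (\<lambda>z. partial_solution N \<eta> z - solution_operator \<eta> z)"
      have "L2_norm \<mu> (\<lambda>z. partial_solution N ?\<zeta> z - ?g z) \<le> cmod a * ?A N + cmod b * ?B N" for N
      proof -
        have "L2_norm \<mu> (\<lambda>z. partial_solution N ?\<zeta> z - ?g z) =
            L2_norm \<mu> (\<lambda>z. a * (partial_solution N \<omega> z - solution_operator \<omega> z) +
              b * (partial_solution N \<eta> z - solution_operator \<eta> z))"
          unfolding part by (simp add: algebra_simps)
        also have "\<dots> \<le> L2_norm \<mu> (\<lambda>z. a * (partial_solution N \<omega> z - solution_operator \<omega> z)) +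
            L2_norm \<mu> (\<lambda>z. b * (partial_solution N \<eta> z - solution_operator \<eta> z))"
          by (intro L2_norm_triangle L2_scale L2_diff L2 L2_partial_solution)
        finally show ?thesis
          by (simp only: L2_norm_scale)
      qed
      then show "\<forall>\<^sub>F N in sequentially. L2_norm \<mu> (\<lambda>z. partial_solution N ?\<zeta> z - ?g z) \<le>
          cmod a * ?A N + cmod b * ?B N"
        by simp
      have "(\<lambda>N. cmod a * ?A N + cmod b * ?B N) \<longlonglongrightarrow> cmod a * 0 + cmod b * 0"
        by (intro tendsto_intros solution_operator_limit \<omega> \<eta>)
      then show "(\<lambda>N. cmod a * ?A N + cmod b * ?B N) \<longlonglongrightarrow> 0"
        by simp
    qed (auto simp: L2_norm_nonneg)
  qed (intro L2_partial_solution solution_operator_limit \<zeta>)+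
qed

text \<open>The operator is a norm limit of the finite-rank operators \<open>partial_solution N\<close>. A diagonal
  subsequence makes all coefficients converge; along it every \<open>partial_solution N\<close> converges, and
  the uniform tail estimate gives the Cauchy property of the images.\<close>

lemma solution_operator_compact_sequence:
  fixes W :: "nat \<Rightarrow> 'n form01"
  assumes W: "\<And>k. W k \<in> L2_forms" and B: "\<And>k. form01_norm \<mu> (W k) \<le> B"
  obtains r g where "strict_mono (r :: nat \<Rightarrow> nat)" "g \<in> L2 \<mu>"
    "(\<lambda>k. L2_norm \<mu> (\<lambda>z. solution_operator (W (r k)) z - g z)) \<longlonglongrightarrow> 0"
proof -
  have "B \<ge> 0"
    using B[of 0] form01_norm_nonneg[of "W 0"] by linarith
  \<comment> \<open>coefficients for the normalised monomials, for which Bessel's inequality gives a uniform bound\<close>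
  define y where "y k i = form_coeff (W k) i * of_real (sqrt (monomial_sqnorm (fst i)))" for k i
  have y_le: "norm (y k i) \<le> B" for k i
  proof -
    have "(cmod (y k i))\<^sup>2 = (\<Sum>i\<in>{i}. (cmod (form_coeff (W k) i))\<^sup>2 * monomial_sqnorm (fst i))"
      using monomial_sqnorm_pos[of "fst i"] by (simp add: y_def norm_mult power_mult_distrib)
    also have "\<dots> \<le> (form01_norm \<mu> (W k))\<^sup>2"
      by (intro Bessel_form W) simp
    also have "\<dots> \<le> B\<^sup>2"
      by (intro power_mono B form01_norm_nonneg)
    finally show ?thesis
      by (rule power2_le_imp_le) (rule \<open>B \<ge> 0\<close>)
  qed
  obtain r :: "nat \<Rightarrow> nat" where r: "strict_mono r"
    and conv: "\<And>i. i \<in> UNIV \<Longrightarrow> \<exists>l. (\<lambda>k. y (r k) i) \<longlonglongrightarrow> l"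
    by (rule function_convergent_subsequence[of UNIV y B, OF countableI_type y_le])
      (rule that, assumption, blast)
  define l where "l i = lim (\<lambda>k. y (r k) i)" for i
  have l: "(\<lambda>k. y (r k) i) \<longlonglongrightarrow> l i" for i
    using conv[of i] by (simp add: l_def convergent_def flip: convergent_LIMSEQ_iff)
  define x where "x i = l i / of_real (sqrt (monomial_sqnorm (fst i)))" for i
  have x: "(\<lambda>k. form_coeff (W (r k)) i) \<longlonglongrightarrow> x i" for i
  proof -
    have "form_coeff (W k) i = y k i / of_real (sqrt (monomial_sqnorm (fst i)))" for k
      using monomial_sqnorm_pos[of "fst i"] by (simp add: y_def)
    then show ?thesis
      unfolding x_def using less_imp_neq[OF monomial_sqnorm_pos[of "fst i"]]
      by (simp only:) (intro tendsto_divide tendsto_const l, simp)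
  qed
  have part: "(\<lambda>k. L2_norm \<mu> (\<lambda>z. partial_solution N (W (r k)) z - solution_sum (indices_below N) x z)) \<longlonglongrightarrow> 0"
    for N
  proof (rule tendsto_sandwich[where f = "\<lambda>_. 0"])
    let ?u = "\<lambda>k. \<Sum>i\<in>indices_below N. cmod (form_coeff (W (r k)) i - x i) *
        L2_norm \<mu> (canonical_solution (fst i) (snd i))"
    have "L2_norm \<mu> (\<lambda>z. partial_solution N (W (r k)) z - solution_sum (indices_below N) x z) \<le> ?u k" for k
    proof -
      have "L2_norm \<mu> (\<lambda>z. partial_solution N (W (r k)) z - solution_sum (indices_below N) x z) =
          L2_norm \<mu> (\<lambda>z. \<Sum>i\<in>indices_below N. (form_coeff (W (r k)) i - x i) *
            canonical_solution (fst i) (snd i) z)"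
        by (simp add: partial_solution_def solution_sum_def left_diff_distrib sum_subtractf)
      also have "\<dots> \<le> (\<Sum>i\<in>indices_below N. L2_norm \<mu> (\<lambda>z. (form_coeff (W (r k)) i - x i) *
            canonical_solution (fst i) (snd i) z))"
        by (intro L2_norm_sum_le L2_scale L2_canonical_solution)
      finally show ?thesis
        by (simp only: L2_norm_scale)
    qed
    then show "\<forall>\<^sub>F k in sequentially.
        L2_norm \<mu> (\<lambda>z. partial_solution N (W (r k)) z - solution_sum (indices_below N) x z) \<le> ?u k"
      by simp
    have "?u \<longlonglongrightarrow> (\<Sum>i\<in>indices_below N. 0 * L2_norm \<mu> (canonical_solution (fst i) (snd i)))"
      by (intro tendsto_intros tendsto_norm_zero LIM_zero x)
    then show "?u \<longlonglongrightarrow> 0"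
      by simp
  qed (auto simp: L2_norm_nonneg)
  have Cauchy: "\<exists>K. \<forall>k\<ge>K. \<forall>l\<ge>K. L2_norm \<mu> (\<lambda>z. solution_operator (W (r k)) z - solution_operator (W (r l)) z) < e"
    if "e > 0" for e
  proof -
    \<comment> \<open>chosen so that each tail is below \<open>e / 4\<close>; the \<open>1\<close> avoids a division by zero\<close>
    define t where "t = (e / 4 / (B + 1))\<^sup>2"
    have t: "t > 0" "sqrt t * B < e / 4"
    proof -
      show "t > 0" using that \<open>B \<ge> 0\<close> by (simp add: t_def)
      have "(e / 4 / (B + 1)) * B < (e / 4 / (B + 1)) * (B + 1)"
        using that \<open>B \<ge> 0\<close> by (intro mult_strict_left_mono) auto
      also have "\<dots> = e / 4"
        using \<open>B \<ge> 0\<close> by (intro nonzero_eq_divide_eq[THEN iffD1]) auto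
      finally have "(e / 4 / (B + 1)) * B < e / 4" .
      moreover have "sqrt t = e / 4 / (B + 1)"
        unfolding t_def using that \<open>B \<ge> 0\<close> by (intro real_sqrt_unique) auto
      ultimately show "sqrt t * B < e / 4"
        by (simp only:)
    qed
    obtain N where N: "\<And>d. d \<ge> N \<Longrightarrow> block_trace d \<le> t"
      using block_trace_eventually_le[OF t(1)] by blast
    define p where "p = solution_sum (indices_below N) x"
    have p: "p \<in> L2 \<mu>"
      unfolding p_def by (rule L2_solution_sum)
    have "\<forall>\<^sub>F k in sequentially. L2_norm \<mu> (\<lambda>z. partial_solution N (W (r k)) z - p z) < e / 4"
      unfolding p_def using order_tendstoD(2)[OF part, of "e / 4"] that by simp
    then obtain K where K: "\<And>k. k \<ge> K \<Longrightarrow> L2_norm \<mu> (\<lambda>z. partial_solution N (W (r k)) z - p z) < e / 4"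
      by (auto simp: eventually_sequentially)
    have near: "L2_norm \<mu> (\<lambda>z. solution_operator (W (r k)) z - p z) < e / 2" if "k \<ge> K" for k
    proof -
      have "L2_norm \<mu> (\<lambda>z. solution_operator (W (r k)) z - p z) \<le>
          L2_norm \<mu> (\<lambda>z. solution_operator (W (r k)) z - partial_solution N (W (r k)) z) +
          L2_norm \<mu> (\<lambda>z. partial_solution N (W (r k)) z - p z)"
        by (intro L2_norm_triangle_diff solution_operator_limit W L2_partial_solution p)
      moreover have "L2_norm \<mu> (\<lambda>z. solution_operator (W (r k)) z - partial_solution N (W (r k)) z) \<le>
          sqrt t * form01_norm \<mu> (W (r k))"
        using t(1) N by (intro solution_operator_tail W) auto
      moreover have "sqrt t * form01_norm \<mu> (W (r k)) \<le> sqrt t * B"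
        using t(1) by (intro mult_left_mono B) auto
      ultimately show ?thesis
        using K[OF that] t(2) by linarith
    qed
    have "L2_norm \<mu> (\<lambda>z. solution_operator (W (r k)) z - solution_operator (W (r l)) z) < e"
      if "k \<ge> K" "l \<ge> K" for k l
    proof -
      have "L2_norm \<mu> (\<lambda>z. solution_operator (W (r k)) z - solution_operator (W (r l)) z) \<le>
          L2_norm \<mu> (\<lambda>z. solution_operator (W (r k)) z - p z) +
          L2_norm \<mu> (\<lambda>z. p z - solution_operator (W (r l)) z)"
        by (intro L2_norm_triangle_diff solution_operator_limit W p)
      then show ?thesis
        using near[OF that(1)] near[OF that(2)] L2_norm_minus_commute[of \<mu> p "solution_operator (W (r l))"]
        by linarith
    qed
    then show ?thesis by blast
  qed
  show thesis
    by (rule L2_complete[OF finite_measure solution_operator_limit(1)[OF W]])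
      (erule Cauchy, rule that[OF r])
qed

lemma compact_solution_operator: "compact_form01_operator \<mu> solution_operator"
  unfolding compact_form01_operator_def
proof (intro conjI allI impI linear_solution_operator A2_form01_L2_forms)
  fix W :: "nat \<Rightarrow> 'n form01" and B
  assume *: "\<forall>k. W k \<in> A2_form01 \<mu> \<and> form01_norm \<mu> (W k) \<le> B"
  have "W k \<in> L2_forms" and "form01_norm \<mu> (W k) \<le> B" for k
    using * A2_form01_L2_forms by auto
  note bounded = this
  show "\<exists>r g. strict_mono r \<and> g \<in> L2 \<mu> \<and>
      (\<lambda>k. L2_norm \<mu> (\<lambda>z. solution_operator (W (r k)) z - g z)) \<longlonglongrightarrow> 0"
    by (rule solution_operator_compact_sequence[of W B, OF bounded]) blast
qed

lemma solution_operator_monomial_form01: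
  "AE z in \<mu>. solution_operator (monomial_form01 \<alpha> j) z = canonical_solution \<alpha> j z"
proof (rule L2_limit_unique_AE[where F = "\<lambda>N. partial_solution N (monomial_form01 \<alpha> j)"])
  have "monomial_form01 \<alpha> j \<in> L2_forms"
    using monomial_form01_polynomial polynomial_form01_L2_forms by blast
  from solution_operator_limit[OF this]
  show "solution_operator (monomial_form01 \<alpha> j) \<in> L2 \<mu>"
    and "(\<lambda>N. L2_norm \<mu> (\<lambda>z. partial_solution N (monomial_form01 \<alpha> j) z -
      solution_operator (monomial_form01 \<alpha> j) z)) \<longlonglongrightarrow> 0" .
  have "\<forall>\<^sub>F N in sequentially. L2_norm \<mu> (\<lambda>z. partial_solution N (monomial_form01 \<alpha> j) z -
      canonical_solution \<alpha> j z) = 0"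
    by (rule eventually_sequentiallyI[of "Suc (total_degree \<alpha>)"])
      (simp add: partial_solution_monomial_form01 L2_norm_zero)
  then show "(\<lambda>N. L2_norm \<mu> (\<lambda>z. partial_solution N (monomial_form01 \<alpha> j) z -
      canonical_solution \<alpha> j z)) \<longlonglongrightarrow> 0"
    by (rule tendsto_eventually)
qed (intro L2_partial_solution L2_canonical_solution)+

lemma canonical_solution_operator_solution_operator:
  "canonical_solution_operator \<mu> solution_operator"
  unfolding canonical_solution_operator_def
proof (intro conjI allI ballI linear_solution_operator polynomial_form01_L2_forms)
  fix \<alpha> :: "'n \<Rightarrow> nat" and j
  let ?T = "solution_operator (monomial_form01 \<alpha> j)"
  let ?p = "\<lambda>z. (- of_real (real (\<alpha> j) * moment_ratio (total_degree \<alpha> - 1))) * monomial (decrement \<alpha> j) z"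
  have T: "?T \<in> L2 \<mu>"
    using monomial_form01_polynomial polynomial_form01_L2_forms by (intro solution_operator_limit) blast
  have d: "(\<lambda>z. ?T z - cnj (z $ j) * monomial \<alpha> z) \<in> L2 \<mu>"
    by (intro L2_diff T L2_cnj_monomial)
  have p: "?p \<in> polynomials"
    by (rule polynomial_monomial)
  have "AE z in \<mu>. (?T z - cnj (z $ j) * monomial \<alpha> z) - ?p z = 0"
    using solution_operator_monomial_form01[of \<alpha> j] by (auto simp: canonical_solution_def)
  then have "L2_norm \<mu> (\<lambda>z. (?T z - cnj (z $ j) * monomial \<alpha> z) - ?p z) = L2_norm \<mu> (\<lambda>z. 0)"
    by (intro L2_norm_cong_AE L2_measurable[OF L2_diff[OF d polynomials_L2[OF p]]] L2_measurable[OF L2_zero])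
  then show "(\<lambda>z. ?T z - cnj (z $ j) * monomial \<alpha> z) \<in> A2 \<mu>"
    unfolding A2_def using d p polynomials_L2[OF p] by (auto simp: L2_norm_zero intro!: bexI[of _ ?p])
  fix g assume g: "g \<in> A2 \<mu>"
  have "L2_inner \<mu> ?T g = L2_inner \<mu> (canonical_solution \<alpha> j) g"
    by (intro L2_inner_cong_AE L2_measurable T A2_L2 g L2_canonical_solution solution_operator_monomial_form01)
  also have "\<dots> = 0"
    by (rule orthogonal_A2[OF L2_canonical_solution canonical_solution_orthogonal_monomial g])
  finally show "L2_inner \<mu> ?T g = 0" .
qed

lemma canonical_solution_operator_compact: "canonical_solution_operator_compact \<mu>"
  unfolding canonical_solution_operator_compact_def
  using canonical_solution_operator_solution_operator compact_solution_operator by auto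

end

section \<open>Necessity\<close>

text \<open>The difference of two solutions that are both orthogonal to \<open>A\<^sup>2\<close> lies in \<open>A\<^sup>2\<close> and is
  orthogonal to itself.\<close>

lemma canonical_solution_operator_monomial_form01:
  assumes "canonical_solution_operator \<mu> S"
  shows "AE z in \<mu>. S (monomial_form01 \<alpha> j) z = canonical_solution \<alpha> j z"
proof -
  let ?S = "S (monomial_form01 \<alpha> j)"
  have S: "?S \<in> L2 \<mu>"
    using assms monomial_form01_polynomial
    by (auto simp: canonical_solution_operator_def linear_form01_operator_def)
  have A: "(\<lambda>z. ?S z - cnj (z $ j) * monomial \<alpha> z) \<in> A2 \<mu>"
    and orth: "\<And>g. g \<in> A2 \<mu> \<Longrightarrow> L2_inner \<mu> ?S g = 0"
    using assms by (auto simp: canonical_solution_operator_def)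
  define h where "h z = ?S z - canonical_solution \<alpha> j z" for z
  have "h \<in> A2 \<mu>"
    using A2_add_polynomial[OF A polynomial_monomial[of
        "of_real (real (\<alpha> j) * moment_ratio (total_degree \<alpha> - 1))" "decrement \<alpha> j"]]
    by (simp add: h_def[abs_def] canonical_solution_def algebra_simps)
  then have "L2_inner \<mu> ?S h = 0" "L2_inner \<mu> (canonical_solution \<alpha> j) h = 0"
    by (rule orth, rule orthogonal_A2[OF L2_canonical_solution canonical_solution_orthogonal_monomial])
  then have "L2_inner \<mu> h h = 0"
    using \<open>h \<in> A2 \<mu>\<close> unfolding h_def[abs_def]
    by (simp add: L2_inner_diff_left S L2_canonical_solution A2_L2)
  then have "L2_norm \<mu> h = 0"
    unfolding L2_inner_self by simp
  from L2_norm_eq_0_AE[OF A2_L2[OF \<open>h \<in> A2 \<mu>\<close>] this] show ?thesis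
    by (simp add: h_def)
qed

text \<open>The normalised forms \<open>z\<^sup>\<alpha> dz\<^sub>j\<^sup>* / \<parallel>z\<^sup>\<alpha>\<parallel>\<close>, with \<open>j\<close> fixed and varying \<open>\<alpha>\<close>, are mapped to
  pairwise orthogonal functions whose squared norms are the solution ratios, and a compact operator
  sends them to a null sequence.\<close>

lemma compact_imp_solution_ratio_null:
  assumes S: "canonical_solution_operator \<mu> S" and T: "compact_form01_operator \<mu> T"
    and TS: "\<And>\<omega>. \<omega> \<in> polynomial_form01 \<Longrightarrow> AE z in \<mu>. T \<omega> z = S \<omega> z"
    and inj: "inj \<alpha>"
  shows "(\<lambda>d. solution_ratio (\<alpha> d) j) \<longlonglongrightarrow> 0"
proof -
  define c where "c d = complex_of_real (1 / sqrt (monomial_sqnorm (\<alpha> d)))" for d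
  \<comment> \<open>a multiple written as a two-term combination, to which linearity applies as it stands\<close>
  define W where "W d = (\<lambda>k z. c d * monomial_form01 (\<alpha> d) j k z + 0 * monomial_form01 (\<alpha> d) j k z)" for d
  define u where "u d z = c d * canonical_solution (\<alpha> d) j z" for d z
  have u: "u d \<in> L2 \<mu>" for d
    unfolding u_def[abs_def] by (intro L2_scale L2_canonical_solution)
  have c: "(cmod (c d))\<^sup>2 = 1 / monomial_sqnorm (\<alpha> d)" for d
    using monomial_sqnorm_pos[of "\<alpha> d"] by (simp add: c_def norm_divide power_divide)
  have nu: "(L2_norm \<mu> (u d))\<^sup>2 = solution_ratio (\<alpha> d) j" for d
    unfolding u_def[abs_def] L2_norm_scale power_mult_distrib c L2_norm_canonical_solution_power2
    using monomial_sqnorm_pos[of "\<alpha> d"] by simp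
  have orth: "L2_inner \<mu> (u d) (u e) = 0" if "d \<noteq> e" for d e
  proof -
    have "increment (\<alpha> d) j \<noteq> increment (\<alpha> e) j"
      using that inj unfolding increment_inject by (auto dest: injD)
    then show ?thesis
      by (simp add: u_def[abs_def] L2_inner_scale_left L2_inner_scale_right canonical_solution_orthogonal)
  qed
  have mf: "monomial_form01 \<gamma> j \<in> A2_form01 \<mu>" for \<gamma>
    using monomial_form01_polynomial[of \<gamma> j] by (auto simp: A2_form01_def polynomial_form01_def polynomials_A2)
  have lin: "linear_form01_operator \<mu> (A2_form01 \<mu>) T"
    using T by (simp add: compact_form01_operator_def)
  have W_apply: "W d k = (\<lambda>z. (if k = j then c d else 0) * monomial (\<alpha> d) z)" for d k
    by (auto simp: W_def monomial_form01_apply)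
  have W_A2: "W d \<in> A2_form01 \<mu>" for d
    unfolding A2_form01_def W_apply by (intro CollectI allI polynomials_A2 polynomial_monomial)
  have W_norm: "form01_norm \<mu> (W d) \<le> 1" for d
  proof -
    have "(L2_norm \<mu> (W d k))\<^sup>2 = (if k = j then 1 else 0)" for k
      unfolding W_apply L2_norm_scale power_mult_distrib L2_norm_monomial_power2
      using monomial_sqnorm_pos[of "\<alpha> d"] by (simp add: c)
    then show ?thesis
      by (simp add: form01_norm_def)
  qed
  have T_W: "T (W d) \<in> L2 \<mu>" for d
    using lin W_A2 by (simp add: linear_form01_operator_def)
  have TW_u: "AE z in \<mu>. T (W d) z = u d z" for d
  proof -
    have "AE z in \<mu>. T (W d) z = c d * T (monomial_form01 (\<alpha> d) j) z + 0 * T (monomial_form01 (\<alpha> d) j) z"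
      using lin mf unfolding linear_form01_operator_def W_def by blast
    moreover have "AE z in \<mu>. T (monomial_form01 (\<alpha> d) j) z = S (monomial_form01 (\<alpha> d) j) z"
      by (rule TS[OF monomial_form01_polynomial])
    moreover have "AE z in \<mu>. S (monomial_form01 (\<alpha> d) j) z = canonical_solution (\<alpha> d) j z"
      by (rule canonical_solution_operator_monomial_form01[OF S])
    ultimately show ?thesis
      by eventually_elim (simp add: u_def)
  qed
  have "(\<lambda>d. L2_norm \<mu> (u d)) \<longlonglongrightarrow> 0"
  proof (rule tendsto_zero_subseqI)
    fix s :: "nat \<Rightarrow> nat" assume s: "strict_mono s"
    have bounded: "\<forall>k. W (s k) \<in> A2_form01 \<mu> \<and> form01_norm \<mu> (W (s k)) \<le> 1"
      using W_A2 W_norm by blast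
    obtain r g where r: "strict_mono r" and g: "g \<in> L2 \<mu>"
      and lim: "(\<lambda>k. L2_norm \<mu> (\<lambda>z. T (W (s (r k))) z - g z)) \<longlonglongrightarrow> 0"
      using mp[OF spec[OF spec[OF conjunct2[OF T[unfolded compact_form01_operator_def]],
            of "\<lambda>k. W (s k)"], of 1] bounded]
      by (elim exE conjE)
    have "L2_norm \<mu> (\<lambda>z. T (W d) z - g z) = L2_norm \<mu> (\<lambda>z. u d z - g z)" for d
    proof (intro L2_norm_cong_AE L2_measurable L2_diff T_W u g)
      show "AE z in \<mu>. T (W d) z - g z = u d z - g z"
        using TW_u[of d] by eventually_elim simp
    qed
    with lim have "(\<lambda>k. L2_norm \<mu> (\<lambda>z. u (s (r k)) z - g z)) \<longlonglongrightarrow> 0"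
      by simp
    moreover have "L2_inner \<mu> (u (s (r k))) (u (s (r l))) = 0" if "k \<noteq> l" for k l
      using that r s by (intro orth) (simp add: strict_mono_eq)
    ultimately have "(\<lambda>k. L2_norm \<mu> (u (s (r k)))) \<longlonglongrightarrow> 0"
      by (intro orthogonal_convergent_imp_null[of "\<lambda>k. u (s (r k))" \<mu> g] u g)
    with r show "\<exists>r. strict_mono r \<and> (\<lambda>k. L2_norm \<mu> (u (s (r k)))) \<longlonglongrightarrow> 0"
      by blast
  qed
  then have "(\<lambda>d. (L2_norm \<mu> (u d))\<^sup>2) \<longlonglongrightarrow> 0\<^sup>2"
    by (rule tendsto_power)
  then show ?thesis
    by (simp add: nu)
qed

text \<open>A block trace is a sum of \<open>n\<close> solution ratios, each of which tends to zero. The multi-indices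
  \<open>\<gamma>\<close> may be any of the respective degrees, since the trace depends on the degree only; here they are
  the multiples of one unit vector.\<close>

lemma compact_imp_block_trace_null:
  assumes "canonical_solution_operator_compact \<mu>"
  shows "block_trace \<longlonglongrightarrow> 0"
proof -
  obtain S T where ST: "canonical_solution_operator \<mu> S" "compact_form01_operator \<mu> T"
    "\<And>\<omega>. \<omega> \<in> polynomial_form01 \<Longrightarrow> AE z in \<mu>. T \<omega> z = S \<omega> z"
    using assms by (auto simp: canonical_solution_operator_compact_def)
  obtain k :: 'n where True
    by blast
  define \<gamma> where "\<gamma> d = (\<lambda>l. if l = k then d else 0)" for d :: nat
  have deg: "total_degree (\<gamma> d) = d" for d
    by (simp add: total_degree_def \<gamma>_def)
  have "(\<lambda>d. \<Sum>j\<in>UNIV. solution_ratio (increment (\<gamma> d) j) j) \<longlonglongrightarrow> (\<Sum>j\<in>(UNIV :: 'n set). 0)"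
  proof (rule tendsto_sum, rule compact_imp_solution_ratio_null[OF ST(1,2)])
    show "AE z in \<mu>. T \<omega> z = S \<omega> z" if "\<omega> \<in> polynomial_form01" for \<omega>
      using ST(3) that .
    fix j
    show "inj (\<lambda>d. increment (\<gamma> d) j)"
      unfolding inj_def increment_inject using deg by metis
  qed
  then have "(\<lambda>d. block_trace (Suc d)) \<longlonglongrightarrow> 0"
    by (simp add: sum_solution_ratio deg)
  then show ?thesis
    by (simp add: filterlim_sequentially_Suc)
qed

lemma block_trace_eq_moments:
  assumes "d > 0"
  shows "block_trace d =
    ((2 * real CARD('n) + real d - 1) * moment \<mu> (d + 1)) / ((real CARD('n) + real d) * moment \<mu> d)
      - moment \<mu> d / moment \<mu> (d - 1)"
proof -
  obtain e where d: "d = Suc e"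
    using assms by (cases d) auto
  have "real CARD('n) + real e \<noteq> 0"
    using card_ge_1 by linarith
  then have ratio: "(real CARD('n) + real e) * moment_ratio e = moment \<mu> (Suc e) / moment \<mu> e"
    unfolding moment_ratio_def times_divide_eq_right by (rule mult_divide_mult_cancel_left)
  have "block_trace d = (2 * real CARD('n) + real d - 1) * moment_ratio d -
      (real CARD('n) + real e) * moment_ratio e"
    by (simp add: block_trace_def d)
  then show ?thesis
    unfolding ratio by (simp add: d moment_ratio_def)
qed

end

theorem corollary7:
  fixes \<mu> :: "(complex^'n) measure"
  assumes "sets \<mu> = sets borel"
    and "rotation_invariant \<mu>"
    and "\<And>d::nat. integrable \<mu> (\<lambda>z. norm z ^ (2 * d))"
    and "\<And>d::nat. 0 < moment \<mu> d"
  shows "canonical_solution_operator_compact \<mu> \<longleftrightarrow>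
    (\<lambda>d::nat.
        ((2 * real CARD('n) + real d - 1) * moment \<mu> (d + 1)) / ((real CARD('n) + real d) * moment \<mu> d)
        - moment \<mu> d / moment \<mu> (d - 1)) \<longlonglongrightarrow> 0"
proof -
  interpret rotation_invariant_measure \<mu>
    by standard (fact assms)+
  let ?f = "\<lambda>d::nat.
        ((2 * real CARD('n) + real d - 1) * moment \<mu> (d + 1)) / ((real CARD('n) + real d) * moment \<mu> d)
        - moment \<mu> d / moment \<mu> (d - 1)"
  have "canonical_solution_operator_compact \<mu> \<longleftrightarrow> block_trace \<longlonglongrightarrow> 0"
    using compact_imp_block_trace_null canonical_solution_operator_compact by blast
  also have "\<dots> \<longleftrightarrow> ?f \<longlonglongrightarrow> 0"
    by (rule tendsto_cong, rule eventually_sequentiallyI[of 1]) (simp only: block_trace_eq_moments)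
  finally show ?thesis .
qed

end
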